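(* Let $p$ be a prime, $d \geq 1$, $V = \mathbb{F}_p^d$, and let $G \leq \mathrm{GL}(V)$ be an irreducible linear group on $V$ such that $p$ divides $|G|$ (so that the affine group $VG$ is a finite primitive permutation group on $V$). Then $\overrightarrow{\mathrm{diam}}(V, G) \leq 9d^3$.
   Context: Vectors are row vectors and $G$ acts on $V$ by right multiplication. The affine group $VG$ is the permutation group $\{ v \mapsto b + vA \mid b \in V, A \in G\}$ on $V$. Its orbital graphs are the orbits of $VG$ on $V \times V$ (viewed as directed graphs on $V$); the nondiagonal ones are exactly the Cayley digraphs on $V$ whose connection set is a nonzero orbit $\mathcal{O}$ of $G$ on $V$, i.e. with an arc $u \to u + w$ for every $u \in V$, $w \in \mathcal{O}$. The directed diameter of such a graph is the maximal directed distance between two vertices (following arcs in their orientation). $\overrightarrow{\mathrm{diam}}(V, G)$ denotes the maximum of the directed diameters of all nondiagonal orbital graphs of $VG$; equivalently, it is the least positive integer $m$ such that $m \cdot (\mathcal{O} \cup \{0\}) = V$ for every nonzero orbit $\mathcal{O}$ of $G$ on $V$, where for a subset $\Delta \subseteq V$, $m \cdot \Delta$ denotes the $m$-fold sumset $\{\delta_1 + \dots + \delta_m \mid \delta_i \in \Delta\}$. *)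

theory Defs
  imports "HOL-Analysis.Analysis"
begin

fun sumset :: "nat \<Rightarrow> 'a::comm_monoid_add set \<Rightarrow> 'a set" where
  "sumset 0 D = {0}"
| "sumset (Suc m) D = {x + y | x y. x \<in> D \<and> y \<in> sumset m D}"

definition orbit_lin :: "('k::field ^ 'n ^ 'n) set \<Rightarrow> 'k ^ 'n \<Rightarrow> ('k ^ 'n) set" where
  "orbit_lin G v = {v v* A | A. A \<in> G}"

definition is_linear_group :: "('k::field ^ 'n ^ 'n) set \<Rightarrow> bool" where
  "is_linear_group G \<longleftrightarrow> mat 1 \<in> G \<and> (\<forall>A\<in>G. invertible A \<and> matrix_inv A \<in> G)
     \<and> (\<forall>A\<in>G. \<forall>B\<in>G. A ** B \<in> G)"

definition irreducible_lin :: "('k::field ^ 'n ^ 'n) set \<Rightarrow> bool" where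
  "irreducible_lin G \<longleftrightarrow> (\<forall>W. vec.subspace W \<and> (\<forall>w\<in>W. \<forall>A\<in>G. w v* A \<in> W)
       \<longrightarrow> W = {0} \<or> W = UNIV)"

text \<open>Maximal directed diameter of the nondiagonal orbital graphs of VG:
  least positive m with m(O \<union> {0}) = V for every nonzero orbit O.\<close>
definition dir_diam :: "('k::field ^ 'n ^ 'n) set \<Rightarrow> nat" where
  "dir_diam G = (LEAST m. 0 < m \<and>
      (\<forall>v. v \<noteq> 0 \<longrightarrow> sumset m (orbit_lin G v \<union> {0}) = (UNIV :: ('k ^ 'n) set)))"

end

theory Submission
  imports "HOL-Algebra.Algebraic_Closure_Type" "HOL-Algebra.Sylow" Defs
begin

text \<open>
  Write \<open>p\<close> for the size of the field, \<open>d\<close> for the dimension and \<open>O\<close> for a nonzero orbit. Suppose that a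
  sumset of \<open>O \<union> {0}\<close> contains a coset of a subspace \<open>U\<close>, \<open>U \<noteq> V\<close>. Let \<open>g\<close> be an element of order \<open>p\<close>. By
  irreducibility there are \<open>x\<close> in \<open>O\<close> and \<open>A\<close> in \<open>G\<close> with \<open>x (g - 1) A \<notin> U\<close>. The points \<open>x g^i A\<close> of \<open>O\<close>
  enlarge \<open>U\<close> to a subspace \<open>U'\<close> at the cost of at most \<open>9 d^2 (dim U' - dim U)\<close> further summands.

  If \<open>p \<le> 9 d^2\<close>, sums of \<open>p - 1\<close> of the two points \<open>x A\<close> and \<open>x g A\<close> form a line. Otherwise, since \<open>g - 1\<close>
  is nilpotent, \<open>i \<mapsto> x g^i A\<close> is a polynomial curve of degree less than \<open>d\<close>; modulo \<open>U\<close> and in a suitable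
  basis its coordinates are monic polynomials \<open>f_l\<close> of distinct degrees \<open>l \<in> K\<close>, where \<open>|K| = dim U' - dim U\<close>.
  It remains to solve the system \<open>\<Sum>i. f_l (x_i) = y_l\<close> (\<open>l \<in> K\<close>) over the prime field in
  \<open>\<Sum>l\<in>K. l (l + 1)\<close> variables.

  By the polynomial method (as for the Chevalley-Warning theorem) it suffices that \<open>\<Prod>l\<in>K. s_l ^ (p - 1)\<close>,
  where \<open>s_l\<close> is the \<open>l\<close>-th power sum of the variables, contains a monomial with all exponents at most
  \<open>p - 1\<close>. This can be tested after specialising the variables over the algebraic closure: for every \<open>l\<close>
  take \<open>l + 1\<close> blocks of \<open>l\<close> variables and replace the variables of a block by \<open>z b\<close>, where \<open>z\<close> runs
  through the \<open>l\<close>-th roots of unity. As \<open>s_j\<close> vanishes on such a block for \<open>0 < j < l\<close>, the coefficient of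
  the right monomial in the block variables \<open>b\<close> is a product of multinomial coefficients and powers of
  the \<open>l\<close>, and these are prime to \<open>p\<close>.
\<close>

section \<open>Power sums over finite fields and over roots of unity\<close>

text \<open>Translation by 1 permutes the field; comparing the sums over all elements shows that
  \<open>CARD('k)\<close> is zero in the field. The characteristic thus divides a prime.\<close>

lemma CHAR_eq_CARD:
  assumes "prime CARD('k::{field,finite})"
  shows "CHAR('k) = CARD('k)"
proof -
  have "(\<Sum>x::'k\<in>UNIV. x + 1) = (\<Sum>x\<in>UNIV. x)"
    by (rule sum.reindex_bij_witness[of _ "\<lambda>x. x - 1" "\<lambda>x. x + 1"]) auto
  then have "of_nat CARD('k) = (0::'k)"
    by (simp add: sum.distrib)
  then have "CHAR('k) dvd CARD('k)"
    by (simp add: of_nat_eq_0_iff_char_dvd)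
  then show ?thesis
    using assms CHAR_not_1 by (metis One_nat_def prime_nat_iff)
qed

lemma nonzero_power_card:
  assumes "x \<noteq> (0 :: 'k::{field,finite})"
  shows "x ^ (CARD('k) - 1) = 1"
proof -
  have "(\<Prod>y\<in>UNIV-{0}. x * y) = (\<Prod>y\<in>UNIV-{0}. y)"
    using assms by (intro prod.reindex_bij_witness[of _ "\<lambda>y. y / x" "\<lambda>y. x * y"]) auto
  then have "x ^ (CARD('k) - 1) * (\<Prod>y\<in>UNIV-{0::'k}. y) = 1 * (\<Prod>y\<in>UNIV-{0}. y)"
    by (simp add: prod.distrib card_Diff_singleton)
  moreover have "(\<Prod>y\<in>UNIV-{0::'k}. y) \<noteq> 0" by simp
  ultimately show ?thesis by (metis mult_cancel_right)
qed

text \<open>Multiplication by a unit \<open>y\<close> permutes the units and scales the sum by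
  \<open>y ^ a\<close>, which forces 0 as soon as some \<open>y ^ a\<close> differs from 1. Such a
  \<open>y\<close> exists because \<open>X ^ r - 1\<close>, with \<open>r\<close> the residue of
  \<open>a\<close>, has fewer roots than there are units. The case \<open>a = 0\<close> is separate
  since \<open>0 ^ 0 = 1\<close>.\<close>

lemma sum_power_UNIV:
  "(\<Sum>x::'k::{field,finite}\<in>UNIV. x ^ a) = (if 0 < a \<and> CARD('k) - 1 dvd a then -1 else 0)"
proof -
  define q where "q = CARD('k)"
  have q2: "q \<ge> 2"
    using card_mono[of "UNIV :: 'k set" "{0, 1}"] by (simp add: q_def)
  have unit: "x ^ (q - 1) = 1" if "x \<noteq> 0" for x :: 'k
    using nonzero_power_card[OF that] by (simp add: q_def)
  have of_q: "of_nat q = (0::'k)"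
  proof -
    have "(\<Sum>x::'k\<in>UNIV. x + 1) = (\<Sum>x\<in>UNIV. x)"
      by (rule sum.reindex_bij_witness[of _ "\<lambda>x. x - 1" "\<lambda>x. x + 1"]) auto
    then show ?thesis by (simp add: sum.distrib q_def)
  qed
  show ?thesis
  proof (cases "a = 0")
    case True
    then show ?thesis using of_q by (simp add: q_def)
  next
    case False
    have nz: "(\<Sum>x::'k\<in>UNIV. x ^ a) = (\<Sum>x\<in>UNIV-{0}. x ^ a)"
      using False by (intro sum.mono_neutral_right) auto
    show ?thesis
    proof (cases "q - 1 dvd a")
      case True
      then obtain m where m: "a = (q - 1) * m" ..
      have "(\<Sum>x::'k\<in>UNIV-{0}. x ^ a) = (\<Sum>x::'k\<in>UNIV-{0}. 1)"
        by (intro sum.cong) (auto simp: m power_mult unit simp del: One_nat_def)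
      also have "\<dots> = of_nat (q - 1)"
        by (simp add: q_def card_Diff_singleton)
      also have "\<dots> = -1"
        using of_q q2 by (simp add: of_nat_diff)
      finally show ?thesis using nz True False by (simp add: q_def)
    next
      case ndvd: False
      define r where "r = a mod (q - 1)"
      have r: "0 < r" "r < q - 1"
        using ndvd q2 by (auto simp: r_def dvd_eq_mod_eq_0)
      have pw: "x ^ a = x ^ r" if "x \<noteq> 0" for x :: 'k
      proof -
        have "x ^ a = x ^ ((q - 1) * (a div (q - 1)) + r)" by (simp add: r_def)
        then show ?thesis using unit[OF that] by (simp add: power_add power_mult)
      qed
      obtain y :: 'k where y: "y \<noteq> 0" "y ^ r \<noteq> 1"
      proof -
        define P :: "'k poly" where "P = monom 1 r - 1"
        have "coeff P r = 1" using r by (simp add: P_def)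
        then have P0: "P \<noteq> 0" by auto
        have "degree P \<le> r"
          unfolding P_def by (intro degree_diff_le) (auto simp: degree_monom_le)
        then have "card {x. poly P x = 0} \<le> r"
          using card_poly_roots_bound[OF P0] by simp
        moreover have "card (UNIV - {0::'k}) = q - 1"
          by (simp add: q_def card_Diff_singleton)
        ultimately have "\<not> UNIV - {0} \<subseteq> {x. poly P x = 0}"
          using r card_mono[of "{x. poly P x = 0}" "UNIV - {0}"] by fastforce
        then show ?thesis using that by (auto simp: P_def poly_monom)
      qed
      have "(\<Sum>x\<in>UNIV-{0}. (y * x) ^ a) = (\<Sum>x\<in>UNIV-{0}. x ^ a)"
        using y by (intro sum.reindex_bij_witness[of _ "\<lambda>x. x / y" "\<lambda>x. y * x"]) auto
      then have "y ^ r * (\<Sum>x\<in>UNIV-{0}. x ^ a) = 1 * (\<Sum>x\<in>UNIV-{0}. x ^ a)"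
        using pw[OF y(1)] by (simp add: power_mult_distrib flip: sum_distrib_left)
      then have "(\<Sum>x::'k\<in>UNIV-{0}. x ^ a) = 0"
        using y(2) by (metis mult_cancel_right)
      then show ?thesis using nz ndvd by (simp add: q_def)
    qed
  qed
qed

section \<open>Roots of unity in an algebraically closed field\<close>

text \<open>\<open>X ^ l - 1\<close> splits into linear factors. A double root would be a root of
  the derivative \<open>l * X ^ (l - 1)\<close>, hence 0, which is not a root of unity.\<close>

lemma card_roots_of_unity:
  assumes "l > 0" "of_nat l \<noteq> (0::'e::alg_closed_field)"
  shows "finite {z::'e. z ^ l = 1}" "card {z::'e. z ^ l = 1} = l"
proof -
  define P :: "'e poly" where "P = monom 1 l - 1"
  have cl: "coeff P l = 1" using assms by (simp add: P_def)
  then have P0: "P \<noteq> 0" by auto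
  have "degree P \<le> l"
    unfolding P_def by (intro degree_diff_le) (auto simp: degree_monom_le)
  with cl have deg: "degree P = l" by (metis le_antisym le_degree zero_neq_one)
  obtain A where A: "size A = degree P" "P = smult (lead_coeff P) (\<Prod>x\<in>#A. [:-x, 1:])"
    using alg_closed_imp_factorization[OF P0] by blast
  have roots: "{z. z ^ l = 1} = set_mset A"
  proof -
    have "poly P z = 0 \<longleftrightarrow> z \<in># A" for z
    proof -
      have "poly P z = lead_coeff P * (\<Prod>x\<in>#A. z - x)"
        by (subst A(2)) (simp add: poly_prod_mset)
      then show ?thesis using P0 by (auto simp: prod_mset_zero_iff)
    qed
    then show ?thesis by (auto simp: P_def poly_monom)
  qed
  have "count A x \<le> 1" for x
  proof (rule ccontr)
    assume "\<not> count A x \<le> 1"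
    then have "{#x, x#} \<subseteq># A" by (simp add: subseteq_mset_def)
    then obtain B where B: "A = {#x, x#} + B" by (auto simp: mset_subset_eq_exists_conv)
    define R where "R = smult (lead_coeff P) (\<Prod>x\<in>#B. [:-x, 1:])"
    have "P = [:-x,1:] * ([:-x,1:] * R)"
      by (subst A(2)) (simp add: B R_def mult_smult_right)
    then have "poly (pderiv P) x = 0"
      by (simp only: pderiv_mult poly_add poly_mult) simp
    moreover have "pderiv P = monom (of_nat l) (l - 1)"
      by (simp add: P_def pderiv_diff pderiv_monom)
    ultimately have "of_nat l * x ^ (l - 1) = 0" by (simp add: poly_monom)
    with assms have "x = 0" by simp
    moreover have "x ^ l = 1" using B roots by auto
    ultimately show False using assms by (simp add: zero_power)
  qed
  then have "A = mset_set (set_mset A)"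
    by (intro multiset_eqI) (simp add: count_mset_set' le_Suc_eq count_eq_zero_iff)
  then have "size A = card (set_mset A)" by (metis size_mset_set)
  then show "finite {z::'e. z ^ l = 1}" "card {z::'e. z ^ l = 1} = l"
    using A deg roots by auto
qed

text \<open>\<open>X ^ j - 1\<close> has at most \<open>j < l\<close> roots, so some
  \<open>l\<close>-th root of unity \<open>u\<close> has \<open>u ^ j \<noteq> 1\<close>.
  Multiplication by \<open>u\<close> permutes the roots and scales the sum by
  \<open>u ^ j\<close>.\<close>

lemma power_sum_roots_of_unity:
  assumes "l > 0" "of_nat l \<noteq> (0::'e::alg_closed_field)" "0 < j" "j < l"
  shows "(\<Sum>z::'e | z ^ l = 1. z ^ j) = 0"
proof -
  let ?Z = "{z::'e. z ^ l = 1}"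
  define P :: "'e poly" where "P = monom 1 j - 1"
  have "coeff P j = 1" using assms by (simp add: P_def)
  then have P0: "P \<noteq> 0" by auto
  have "degree P \<le> j"
    unfolding P_def by (intro degree_diff_le) (auto simp: degree_monom_le)
  then have "card {x. poly P x = 0} < card ?Z"
    using card_poly_roots_bound[OF P0] assms card_roots_of_unity(2)[OF assms(1,2)] by simp
  then have "\<not> ?Z \<subseteq> {x. poly P x = 0}"
    using card_mono[OF poly_roots_finite[OF P0], of ?Z] by linarith
  then obtain u :: 'e where u: "u ^ l = 1" "u ^ j \<noteq> 1" by (auto simp: P_def poly_monom)
  then have u0: "u \<noteq> 0" using assms by (auto simp: zero_power)
  have "(\<Sum>z\<in>?Z. (u * z) ^ j) = (\<Sum>z\<in>?Z. z ^ j)"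
    using u u0 by (intro sum.reindex_bij_witness[of _ "\<lambda>x. x / u" "\<lambda>x. u * x"])
      (auto simp: power_mult_distrib power_divide)
  then have "u ^ j * (\<Sum>z\<in>?Z. z ^ j) = 1 * (\<Sum>z\<in>?Z. z ^ j)"
    by (simp add: power_mult_distrib flip: sum_distrib_left)
  then show ?thesis using u(2) by (metis mult_cancel_right)
qed

section \<open>Multinomial coefficients\<close>

text \<open>Choose the fibre over one point \<open>b0\<close>, then map the remaining elements to
  the other points. The product form shows that the multinomial coefficient divides
  \<open>fact (card A)\<close>, so it is prime to every prime above \<open>card A\<close>.\<close>

lemma card_maps_with_fibre_sizes:
  assumes "finite B" "finite A" "(\<Sum>b\<in>B. c b) = card A"
  shows "card {f \<in> A \<rightarrow>\<^sub>E B. \<forall>b\<in>B. card {a\<in>A. f a = b} = c b} * (\<Prod>b\<in>B. fact (c b)) = fact (card A)"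
  using assms
proof (induction B arbitrary: A rule: finite_induct)
  case empty
  then have "A = {}" by simp
  then show ?case by simp
next
  case (insert b0 B)
  define \<Omega> where "\<Omega> A B = {f \<in> A \<rightarrow>\<^sub>E B. \<forall>b\<in>B. card {a\<in>A. f a = b} = c b}" for A :: "'b set" and B :: "'a set"
  define S where "S = {Y. Y \<subseteq> A \<and> card Y = c b0}"
  have finS: "finite S" unfolding S_def using insert.prems by simp
  have fin\<Omega>: "finite (\<Omega> Y B)" if "finite Y" for Y
    unfolding \<Omega>_def using insert.hyps that by (simp add: finite_PiE)
  have "bij_betw (\<lambda>f. ({a\<in>A. f a = b0}, restrict f {a\<in>A. f a \<noteq> b0})) (\<Omega> A (insert b0 B))
      (SIGMA Y:S. \<Omega> (A - Y) B)"
  proof (rule bij_betw_byWitness[where f' = "\<lambda>(Y, g). (\<lambda>a\<in>A. if a \<in> Y then b0 else g a)"])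
    show "\<forall>f\<in>\<Omega> A (insert b0 B). (\<lambda>(Y, g). (\<lambda>a\<in>A. if a \<in> Y then b0 else g a))
       ({a\<in>A. f a = b0}, restrict f {a\<in>A. f a \<noteq> b0}) = f"
      by (auto simp: \<Omega>_def PiE_def extensional_def fun_eq_iff)
    show "\<forall>p\<in>(SIGMA Y:S. \<Omega> (A - Y) B). (\<lambda>f. ({a\<in>A. f a = b0}, restrict f {a\<in>A. f a \<noteq> b0}))
       ((\<lambda>(Y, g). (\<lambda>a\<in>A. if a \<in> Y then b0 else g a)) p) = p"
    proof
      fix p assume "p \<in> (SIGMA Y:S. \<Omega> (A - Y) B)"
      then obtain Y g where p: "p = (Y, g)" and "Y \<in> S" "g \<in> \<Omega> (A - Y) B" by blast
      then have Y: "Y \<subseteq> A" and g: "\<And>a. a \<in> A - Y \<Longrightarrow> g a \<in> B" "\<And>a. a \<notin> A - Y \<Longrightarrow> g a = undefined"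
        by (auto simp: S_def \<Omega>_def PiE_def extensional_def)
      have gb: "g a \<noteq> b0" if "a \<in> A" "a \<notin> Y" for a
        using g(1)[of a] that insert.hyps(2) by auto
      have 1: "{a\<in>A. (\<lambda>a\<in>A. if a \<in> Y then b0 else g a) a = b0} = Y"
        using Y gb by (auto split: if_splits)
      have 2: "{a\<in>A. (\<lambda>a\<in>A. if a \<in> Y then b0 else g a) a \<noteq> b0} = A - Y"
        using 1 by blast
      have 3: "restrict (\<lambda>a\<in>A. if a \<in> Y then b0 else g a) (A - Y) = g"
        using g(2) by (auto simp: fun_eq_iff restrict_def)
      show "(\<lambda>f. ({a\<in>A. f a = b0}, restrict f {a\<in>A. f a \<noteq> b0}))
         ((\<lambda>(Y, g). (\<lambda>a\<in>A. if a \<in> Y then b0 else g a)) p) = p"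
        unfolding p prod.case 1 2 3 ..
    qed
    show "(\<lambda>f. ({a\<in>A. f a = b0}, restrict f {a\<in>A. f a \<noteq> b0})) ` \<Omega> A (insert b0 B)
       \<subseteq> (SIGMA Y:S. \<Omega> (A - Y) B)"
    proof (rule image_subsetI)
      fix f assume "f \<in> \<Omega> A (insert b0 B)"
      then have f: "f \<in> A \<rightarrow>\<^sub>E insert b0 B" "card {a\<in>A. f a = b0} = c b0"
        "\<And>b. b \<in> B \<Longrightarrow> card {a \<in> A. f a = b} = c b" by (auto simp: \<Omega>_def)
      let ?Y = "{a\<in>A. f a = b0}" and ?g = "restrict f {a\<in>A. f a \<noteq> b0}"
      have "{a \<in> A - ?Y. ?g a = b} = {a\<in>A. f a = b}" if "b \<in> B" for b
        using that insert.hyps(2) by auto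
      moreover have "?g \<in> (A - ?Y) \<rightarrow>\<^sub>E B"
        using f(1) by (auto simp: PiE_def Pi_def extensional_def)
      ultimately have "?g \<in> \<Omega> (A - ?Y) B" using f(3) by (simp add: \<Omega>_def)
      moreover have "?Y \<in> S" using f(2) by (auto simp: S_def)
      ultimately show "(?Y, ?g) \<in> (SIGMA Y:S. \<Omega> (A - Y) B)" by (rule SigmaI[rotated])
    qed
    show "(\<lambda>(Y, g). (\<lambda>a\<in>A. if a \<in> Y then b0 else g a)) ` (SIGMA Y:S. \<Omega> (A - Y) B)
       \<subseteq> \<Omega> A (insert b0 B)"
    proof (rule image_subsetI)
      fix p assume "p \<in> (SIGMA Y:S. \<Omega> (A - Y) B)"
      then obtain Y g where p: "p = (Y, g)" and Y: "Y \<subseteq> A" "card Y = c b0"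
        and g: "g \<in> (A - Y) \<rightarrow>\<^sub>E B" "\<And>b. b \<in> B \<Longrightarrow> card {a\<in>A - Y. g a = b} = c b"
        by (auto simp: S_def \<Omega>_def)
      let ?f = "\<lambda>a\<in>A. if a \<in> Y then b0 else g a"
      have "{a\<in>A. ?f a = b0} = Y"
        using Y g(1) insert.hyps(2) by (auto simp: PiE_def Pi_def split: if_splits)
      moreover have "{a\<in>A. ?f a = b} = {a\<in>A - Y. g a = b}" if "b \<in> B" for b
        using that insert.hyps(2) by auto
      moreover have "?f \<in> A \<rightarrow>\<^sub>E insert b0 B"
        using g(1) by (auto simp: PiE_def Pi_def)
      ultimately show "(\<lambda>(Y, g). (\<lambda>a\<in>A. if a \<in> Y then b0 else g a)) p \<in> \<Omega> A (insert b0 B)"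
        unfolding p prod.case \<Omega>_def using Y g(2) by simp
    qed
  qed
  then have "card (\<Omega> A (insert b0 B)) = card (SIGMA Y:S. \<Omega> (A - Y) B)"
    by (rule bij_betw_same_card)
  also have "\<dots> = (\<Sum>Y\<in>S. card (\<Omega> (A - Y) B))"
    using finS fin\<Omega> insert.prems by (intro card_SigmaI) auto
  finally have eq: "card (\<Omega> A (insert b0 B)) = (\<Sum>Y\<in>S. card (\<Omega> (A - Y) B))" .
  have c: "c b0 \<le> card A" "(\<Sum>b\<in>B. c b) = card A - c b0"
    using insert.prems(2) insert.hyps by auto
  have IH: "card (\<Omega> (A - Y) B) * (\<Prod>b\<in>B. fact (c b)) = fact (card A - c b0)" if "Y \<in> S" for Y
  proof -
    have "card (A - Y) = card A - c b0"
      using that insert.prems by (auto simp: S_def card_Diff_subset finite_subset)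
    then show ?thesis using insert.IH[of "A - Y"] insert.prems c unfolding \<Omega>_def by simp
  qed
  have "card (\<Omega> A (insert b0 B)) * (\<Prod>b\<in>B. fact (c b)) = (\<Sum>Y\<in>S. fact (card A - c b0))"
    unfolding eq sum_distrib_right by (intro sum.cong refl IH)
  also have "\<dots> = (card A choose c b0) * fact (card A - c b0)"
    using n_subsets[OF insert.prems(1), of "c b0"] by (simp add: S_def)
  finally have "card (\<Omega> A (insert b0 B)) * (\<Prod>b\<in>insert b0 B. fact (c b))
      = fact (c b0) * fact (card A - c b0) * (card A choose c b0)"
    using insert.hyps by (simp add: mult_ac)
  also have "\<dots> = fact (card A)"
    using c by (simp add: binomial_fact_lemma)
  finally show ?case unfolding \<Omega>_def .
qed

section \<open>Functions of bounded degree on a finite affine space\<close>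

text \<open>Points have coordinates in the finite field, but values lie in its algebraic closure,
  where the weights (roots of unity) live.\<close>

definition monom_fun :: "'i set \<Rightarrow> ('i \<Rightarrow> nat) \<Rightarrow> ('i \<Rightarrow> 'k::field) \<Rightarrow> 'k alg_closure" where
  "monom_fun I e x = (\<Prod>i\<in>I. to_ac (x i) ^ e i)"

text \<open>Some polynomial of degree below \<open>n\<close> represents the function. Functions
  suffice here because only their values on the finite space are summed. The strict bound leaves
  just the zero function for \<open>n = 0\<close>.\<close>

inductive deg_less :: "'i set \<Rightarrow> nat \<Rightarrow> (('i \<Rightarrow> 'k::field) \<Rightarrow> 'k alg_closure) \<Rightarrow> bool" for I n where
  zero: "deg_less I n (\<lambda>x. 0)"
| monom: "sum e I < n \<Longrightarrow> deg_less I n (\<lambda>x. c * monom_fun I e x)"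
| add: "deg_less I n f \<Longrightarrow> deg_less I n g \<Longrightarrow> deg_less I n (\<lambda>x. f x + g x)"

lemma deg_less_mono: "deg_less I n f \<Longrightarrow> n \<le> m \<Longrightarrow> deg_less I m f"
  by (induction rule: deg_less.induct) (auto intro: deg_less.intros)

text \<open>\<open>Suc m\<close> encodes degree at most \<open>m\<close> for one factor; together
  with degree below \<open>n\<close> for the other this keeps the product strictly below
  \<open>m + n\<close>.\<close>

lemma deg_less_mult:
  assumes "deg_less I (Suc m) f" "deg_less I n g"
  shows "deg_less I (m + n) (\<lambda>x. f x * g x)"
  using assms(1)
proof induction
  case zero
  then show ?case by (simp add: deg_less.zero)
next
  case (monom e c)
  show ?case using assms(2)
  proof induction
    case zero
    then show ?case by (simp add: deg_less.zero)
  next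
    case (monom e' c')
    have "deg_less I (m + n) (\<lambda>x. (c * c') * monom_fun I (\<lambda>i. e i + e' i) x)"
      using monom \<open>sum e I < Suc m\<close> by (intro deg_less.monom) (simp add: sum.distrib)
    then show ?case by (simp add: monom_fun_def power_add prod.distrib mult_ac)
  next
    case (add f g)
    from deg_less.add[OF add.IH] show ?case by (simp add: distrib_left)
  qed
next
  case (add f g)
  from deg_less.add[OF add.IH] show ?case by (simp add: distrib_right)
qed

lemma deg_less_const: "0 < n \<Longrightarrow> deg_less I n (\<lambda>x. c)"
  using deg_less.monom[of "\<lambda>_. 0" I n c] by (simp add: monom_fun_def)

lemma deg_less_cmult: "deg_less I n f \<Longrightarrow> deg_less I n (\<lambda>x. c * f x)"
  using deg_less_mult[OF deg_less_const[of "Suc 0" I c]] by simp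

lemma deg_less_uminus: "deg_less I n f \<Longrightarrow> deg_less I n (\<lambda>x. - f x)"
  using deg_less_cmult[of I n f "-1"] by simp

lemma deg_less_sum: "(\<And>a. a \<in> A \<Longrightarrow> deg_less I n (f a)) \<Longrightarrow> deg_less I n (\<lambda>x. \<Sum>a\<in>A. f a x)"
  by (induction A rule: infinite_finite_induct) (auto intro: deg_less.intros)

lemma deg_less_var_power:
  assumes "finite I" "i \<in> I" "k < n"
  shows "deg_less I n (\<lambda>x :: 'i \<Rightarrow> 'k::field. to_ac (x i) ^ k)"
proof -
  have "monom_fun I (\<lambda>j. if j = i then k else 0) x = to_ac (x i) ^ k" for x :: "'i \<Rightarrow> 'k"
  proof -
    have "monom_fun I (\<lambda>j. if j = i then k else 0) x = (\<Prod>j\<in>I. if j = i then to_ac (x j) ^ k else 1)"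
      unfolding monom_fun_def by (intro prod.cong) auto
    then show ?thesis using assms by simp
  qed
  then have "monom_fun I (\<lambda>j. if j = i then k else 0) = (\<lambda>x :: 'i \<Rightarrow> 'k. to_ac (x i) ^ k)" ..
  moreover have "deg_less I n (\<lambda>x :: 'i \<Rightarrow> 'k. 1 * monom_fun I (\<lambda>j. if j = i then k else 0) x)"
    using assms by (intro deg_less.monom) simp
  ultimately show ?thesis by simp
qed

section \<open>Leading forms\<close>

text \<open>Both functions have degree at most \<open>n\<close> and the same part of degree
  \<open>n\<close>. No homogeneous parts have to be formed.\<close>

definition same_top :: "'i set \<Rightarrow> nat \<Rightarrow> (('i \<Rightarrow> 'k::field) \<Rightarrow> 'k alg_closure) \<Rightarrow> (('i \<Rightarrow> 'k) \<Rightarrow> 'k alg_closure) \<Rightarrow> bool"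
  where "same_top I n f g \<longleftrightarrow> deg_less I (Suc n) g \<and> deg_less I n (\<lambda>x. f x - g x)"

text \<open>\<open>f f' - g g'\<close> is the sum of \<open>g (f' - g')\<close>,
  \<open>g' (f - g)\<close> and \<open>(f - g) (f' - g')\<close>, and each of these has degree below
  \<open>m + n\<close>.\<close>

lemma same_top_mult:
  assumes "same_top I m f g" "same_top I n f' g'"
  shows "same_top I (m + n) (\<lambda>x. f x * f' x) (\<lambda>x. g x * g' x)"
proof -
  have 1: "deg_less I (m + n) (\<lambda>x. g x * (f' x - g' x))"
    using assms by (intro deg_less_mult) (auto simp: same_top_def)
  have 2: "deg_less I (n + m) (\<lambda>x. g' x * (f x - g x))"
    using assms by (intro deg_less_mult) (auto simp: same_top_def)
  have "deg_less I (m + n) (\<lambda>x. (f x - g x) * (f' x - g' x))"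
    using assms by (intro deg_less_mult) (auto simp: same_top_def elim: deg_less_mono)
  from deg_less.add[OF deg_less.add[OF 1 2[unfolded add.commute[of n m]]] this]
  have "deg_less I (m + n) (\<lambda>x. f x * f' x - g x * g' x)"
    by (simp add: algebra_simps)
  moreover have "deg_less I (m + Suc n) (\<lambda>x. g x * g' x)"
    using assms by (intro deg_less_mult) (auto simp: same_top_def)
  ultimately show ?thesis by (simp add: same_top_def)
qed

lemma same_top_prod:
  "finite A \<Longrightarrow> (\<And>a. a \<in> A \<Longrightarrow> same_top I (n a) (f a) (g a)) \<Longrightarrow>
   same_top I (\<Sum>a\<in>A. n a) (\<lambda>x. \<Prod>a\<in>A. f a x) (\<lambda>x. \<Prod>a\<in>A. g a x)"
proof (induction A rule: finite_induct)
  case empty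
  show ?case by (simp add: same_top_def deg_less_const deg_less.zero)
next
  case (insert a A)
  then show ?case by (simp add: same_top_mult)
qed

lemma same_top_sum:
  "(\<And>a. a \<in> A \<Longrightarrow> same_top I n (f a) (g a)) \<Longrightarrow> same_top I n (\<lambda>x. \<Sum>a\<in>A. f a x) (\<lambda>x. \<Sum>a\<in>A. g a x)"
  unfolding same_top_def by (auto intro!: deg_less_sum simp flip: sum_subtractf)

lemma same_top_uminus: "same_top I n f g \<Longrightarrow> same_top I n (\<lambda>x. - f x) (\<lambda>x. - g x)"
  unfolding same_top_def using deg_less_uminus[of I "Suc n" g] deg_less_uminus[of I n "\<lambda>x. f x - g x"]
  by simp

lemma same_top_add_const:
  assumes "same_top I n f g" "0 < n"
  shows "same_top I n (\<lambda>x. f x + c) g"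
  using deg_less.add[of I n "\<lambda>x. f x - g x" "\<lambda>x. c"] deg_less_const[of n I c] assms
  by (simp add: same_top_def algebra_simps)

lemma same_top_poly:
  assumes "finite I" "i \<in> I" "degree P = n" "lead_coeff P = 1"
  shows "same_top I n (\<lambda>x. to_ac (poly P (x i))) (\<lambda>x. to_ac (x i) ^ n)"
proof -
  have eq: "to_ac (poly P (x i)) - to_ac (x i) ^ n = (\<Sum>k<n. to_ac (coeff P k) * to_ac (x i) ^ k)" for x :: "_ \<Rightarrow> 'b"
  proof -
    have "poly P (x i) = (\<Sum>k<n. coeff P k * x i ^ k) + x i ^ n"
      using assms by (simp add: poly_altdef lessThan_Suc_atMost[symmetric])
    then show ?thesis by (simp add: to_ac_sum)
  qed
  show ?thesis unfolding same_top_def eq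
    using assms by (auto intro!: deg_less_sum deg_less_cmult deg_less_var_power)
qed

text \<open>As \<open>\<Sum>x. x ^ a\<close> over a field of size \<open>q\<close> vanishes unless \<open>q - 1\<close> divides \<open>a > 0\<close>, this functional
  reads off, with weights \<open>\<zeta>\<close>, the coefficients of the monomials with exponents in \<open>S\<close>, up to
  monomials of higher degree.\<close>

definition coeff_functional ::
  "'i set \<Rightarrow> ('i \<Rightarrow> nat) set \<Rightarrow> ('i \<Rightarrow> 'k::{field,finite} alg_closure) \<Rightarrow> (('i \<Rightarrow> 'k) \<Rightarrow> 'k alg_closure) \<Rightarrow> 'k alg_closure"
  where "coeff_functional I S \<zeta> h =
    (\<Sum>x\<in>I \<rightarrow>\<^sub>E UNIV. (\<Sum>\<epsilon>\<in>S. \<Prod>i\<in>I. - (\<zeta> i ^ \<epsilon> i) * to_ac (x i) ^ (CARD('k) - 1 - \<epsilon> i)) * h x)"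

lemma coeff_functional_add:
  "coeff_functional I S \<zeta> (\<lambda>x. f x + g x) = coeff_functional I S \<zeta> f + coeff_functional I S \<zeta> g"
  by (simp add: coeff_functional_def sum.distrib distrib_left)

lemma coeff_functional_sum:
  "coeff_functional I S \<zeta> (\<lambda>x. \<Sum>a\<in>A. f a x) = (\<Sum>a\<in>A. coeff_functional I S \<zeta> (f a))"
  unfolding coeff_functional_def sum_distrib_left by (rule sum.swap)

lemma coeff_functional_cmult:
  "coeff_functional I S \<zeta> (\<lambda>x. c * f x) = c * coeff_functional I S \<zeta> f"
  by (simp add: coeff_functional_def sum_distrib_left mult_ac)

text \<open>The sum over all points factors into one power sum per coordinate. The value -1 of a
  nonvanishing power sum cancels the sign built into the weight.\<close>

lemma coeff_functional_monom:
  fixes \<zeta> :: "'i \<Rightarrow> 'k::{field,finite} alg_closure"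
  assumes "finite I"
  shows "coeff_functional I S \<zeta> (monom_fun I e) = (\<Sum>\<epsilon>\<in>S. \<Prod>i\<in>I. \<zeta> i ^ \<epsilon> i *
     (if 0 < CARD('k) - 1 - \<epsilon> i + e i \<and> CARD('k) - 1 dvd CARD('k) - 1 - \<epsilon> i + e i then 1 else 0))"
proof -
  let ?q = "CARD('k) - 1"
  have "coeff_functional I S \<zeta> (monom_fun I e) =
     (\<Sum>x\<in>I \<rightarrow>\<^sub>E UNIV. \<Sum>\<epsilon>\<in>S. \<Prod>i\<in>I. - (\<zeta> i ^ \<epsilon> i) * to_ac (x i) ^ (?q - \<epsilon> i + e i))"
    unfolding coeff_functional_def monom_fun_def sum_distrib_right prod.distrib[symmetric]
    by (simp add: power_add mult.assoc)
  also have "\<dots> = (\<Sum>\<epsilon>\<in>S. \<Sum>x\<in>I \<rightarrow>\<^sub>E UNIV. \<Prod>i\<in>I. - (\<zeta> i ^ \<epsilon> i) * to_ac (x i) ^ (?q - \<epsilon> i + e i))"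
    by (rule sum.swap)
  also have "\<dots> = (\<Sum>\<epsilon>\<in>S. \<Prod>i\<in>I. \<Sum>y\<in>UNIV. - (\<zeta> i ^ \<epsilon> i) * to_ac y ^ (?q - \<epsilon> i + e i))"
    using assms by (intro sum.cong refl prod_sum_PiE[symmetric]) auto
  also have "\<dots> = (\<Sum>\<epsilon>\<in>S. \<Prod>i\<in>I. \<zeta> i ^ \<epsilon> i *
     (if 0 < ?q - \<epsilon> i + e i \<and> ?q dvd ?q - \<epsilon> i + e i then 1 else 0))"
  proof (intro sum.cong prod.cong refl)
    fix \<epsilon> i
    have "(\<Sum>y\<in>UNIV. - (\<zeta> i ^ \<epsilon> i) * to_ac y ^ (?q - \<epsilon> i + e i)) =
       - (\<zeta> i ^ \<epsilon> i) * to_ac (\<Sum>y\<in>UNIV. y ^ (?q - \<epsilon> i + e i))"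
      by (simp add: to_ac_sum sum_distrib_left)
    then show "(\<Sum>y\<in>UNIV. - (\<zeta> i ^ \<epsilon> i) * to_ac y ^ (?q - \<epsilon> i + e i)) = \<zeta> i ^ \<epsilon> i *
     (if 0 < ?q - \<epsilon> i + e i \<and> ?q dvd ?q - \<epsilon> i + e i then 1 else 0)"
      by (simp add: sum_power_UNIV)
  qed
  finally show ?thesis .
qed

text \<open>Since all exponent vectors in \<open>S\<close> have the same total degree
  \<open>N\<close>, with entries at most \<open>CARD('k) - 1\<close>, the functional ignores
  everything of degree below \<open>N\<close>.\<close>

context
  fixes I :: "'i set" and S :: "('i \<Rightarrow> nat) set" and \<zeta> :: "'i \<Rightarrow> 'k::{field,finite} alg_closure" and N :: nat
  assumes fin: "finite I" and S: "S \<subseteq> I \<rightarrow>\<^sub>E {..CARD('k) - 1}" and SN: "\<And>\<epsilon>. \<epsilon> \<in> S \<Longrightarrow> sum \<epsilon> I = N"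
begin

text \<open>In a nonzero term \<open>CARD('k) - 1\<close> divides a positive number, which is
  therefore at least \<open>CARD('k) - 1\<close>. The natural subtraction is exact because of the
  bound on the entries of \<open>\<epsilon>\<close>.\<close>

lemma exponents_le:
  assumes "\<epsilon> \<in> S" "(\<Prod>i\<in>I. \<zeta> i ^ \<epsilon> i *
     (if 0 < CARD('k) - 1 - \<epsilon> i + e i \<and> CARD('k) - 1 dvd CARD('k) - 1 - \<epsilon> i + e i then 1 else 0)) \<noteq> 0"
     and "i \<in> I"
  shows "\<epsilon> i \<le> e i"
proof -
  have "0 < CARD('k) - 1 - \<epsilon> i + e i \<and> CARD('k) - 1 dvd CARD('k) - 1 - \<epsilon> i + e i"
    (is ?C)
  proof -
    have "C" if "a * (if C then 1 else 0) \<noteq> 0" for C and a :: "'k alg_closure"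
      using that by (cases C) auto
    moreover have "F i \<noteq> 0" if "prod F I \<noteq> 0" for F :: "'i \<Rightarrow> 'k alg_closure"
      using that fin assms(3) by auto
    note this[OF assms(2)]
    ultimately show ?thesis .
  qed
  then have "CARD('k) - 1 \<le> CARD('k) - 1 - \<epsilon> i + e i" by (metis dvd_imp_le)
  moreover have "\<epsilon> i \<le> CARD('k) - 1" using S assms(1,3) by (auto simp: PiE_def Pi_def)
  ultimately show ?thesis by linarith
qed

lemma coeff_functional_monom_low:
  assumes "sum e I < N"
  shows "coeff_functional I S \<zeta> (monom_fun I e) = 0"
  unfolding coeff_functional_monom[OF fin]
proof (rule sum.neutral, rule ballI, rule ccontr)
  fix \<epsilon> assume "\<epsilon> \<in> S" "(\<Prod>i\<in>I. \<zeta> i ^ \<epsilon> i *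
     (if 0 < CARD('k) - 1 - \<epsilon> i + e i \<and> CARD('k) - 1 dvd CARD('k) - 1 - \<epsilon> i + e i then 1 else 0)) \<noteq> 0"
  from exponents_le[OF this] have "sum \<epsilon> I \<le> sum e I" by (intro sum_mono)
  then show False using assms SN[OF \<open>\<epsilon> \<in> S\<close>] by simp
qed

text \<open>A surviving \<open>\<epsilon>\<close> is below \<open>e\<close> in every coordinate and
  has the same total, so it equals \<open>e\<close> on \<open>I\<close>. The restriction appears
  because \<open>S\<close> consists of extensional functions.\<close>

lemma coeff_functional_monom_top:
  assumes "sum e I = N"
  shows "coeff_functional I S \<zeta> (monom_fun I e) = (if restrict e I \<in> S then \<Prod>i\<in>I. \<zeta> i ^ e i else 0)"
proof -
  have finS: "finite S" using S fin finite_PiE[of I "\<lambda>_. {..CARD('k) - 1}"] by (auto intro: finite_subset)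
  let ?t = "\<lambda>\<epsilon>. \<Prod>i\<in>I. \<zeta> i ^ \<epsilon> i *
     (if 0 < CARD('k) - 1 - \<epsilon> i + e i \<and> CARD('k) - 1 dvd CARD('k) - 1 - \<epsilon> i + e i then 1 else 0)"
  have eq: "\<epsilon> = restrict e I" if "\<epsilon> \<in> S" "?t \<epsilon> \<noteq> 0" for \<epsilon>
  proof -
    have le: "\<epsilon> i \<le> e i" if "i \<in> I" for i using exponents_le[OF \<open>\<epsilon> \<in> S\<close> \<open>?t \<epsilon> \<noteq> 0\<close> that] .
    have "\<epsilon> i = e i" if "i \<in> I" for i
    proof (rule ccontr)
      assume "\<epsilon> i \<noteq> e i"
      then have "sum \<epsilon> I < sum e I"
        using le that fin by (intro sum_strict_mono_ex1) (auto intro!: bexI[of _ i] le_neq_implies_less)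
      then show False using assms SN[OF \<open>\<epsilon> \<in> S\<close>] by simp
    qed
    then show ?thesis using \<open>\<epsilon> \<in> S\<close> S by (auto simp: fun_eq_iff PiE_def extensional_def)
  qed
  have "(\<Sum>\<epsilon>\<in>S. t \<epsilon>) = (\<Sum>\<epsilon>\<in>S. if \<epsilon> = restrict e I then t \<epsilon> else 0)"
    if "\<And>\<epsilon>. \<epsilon> \<in> S \<Longrightarrow> t \<epsilon> \<noteq> 0 \<Longrightarrow> \<epsilon> = restrict e I" for t :: "_ \<Rightarrow> 'k alg_closure"
    using that by (intro sum.cong) auto
  from this[of ?t, OF eq]
  have "(\<Sum>\<epsilon>\<in>S. ?t \<epsilon>) = (if restrict e I \<in> S then ?t (restrict e I) else 0)"
    unfolding sum.delta[OF finS] .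
  also have "\<dots> = (if restrict e I \<in> S then \<Prod>i\<in>I. \<zeta> i ^ e i else 0)"
  proof (intro if_cong refl prod.cong)
    fix i assume S': "restrict e I \<in> S" and i: "i \<in> I"
    have "restrict e I i \<le> CARD('k) - 1" using S S' i by (auto simp: PiE_def Pi_def)
    then have "e i \<le> CARD('k) - 1" using i by simp
    moreover have "CARD('k) - 1 > 0"
      using card_mono[of "UNIV :: 'k set" "{0, 1}"] by simp
    ultimately show "\<zeta> i ^ restrict e I i * (if 0 < CARD('k) - 1 - restrict e I i + e i \<and>
      CARD('k) - 1 dvd CARD('k) - 1 - restrict e I i + e i then 1 else 0) = \<zeta> i ^ e i"
      using i by simp
  qed
  finally show ?thesis unfolding coeff_functional_monom[OF fin] .
qed

lemma coeff_functional_deg_less: "deg_less I N h \<Longrightarrow> coeff_functional I S \<zeta> h = 0"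
proof (induction rule: deg_less.induct)
  case zero
  then show ?case by (simp add: coeff_functional_def)
next
  case (monom e c)
  then show ?case using coeff_functional_cmult[of I S \<zeta> c "monom_fun I e"] coeff_functional_monom_low by simp
next
  case (add f g)
  then show ?case by (simp add: coeff_functional_add)
qed

lemma coeff_functional_same_top:
  assumes "same_top I N f g"
  shows "coeff_functional I S \<zeta> f = coeff_functional I S \<zeta> g"
proof -
  have "coeff_functional I S \<zeta> (\<lambda>x. g x + (f x - g x)) = coeff_functional I S \<zeta> g"
    unfolding coeff_functional_add using assms by (simp add: same_top_def coeff_functional_deg_less)
  then show ?thesis by simp
qed

end

section \<open>Systems of power sum type\<close>

text \<open>\<open>T\<close> indexes the factors of the product of the \<open>s_l ^ (p - 1)\<close>,
  and \<open>I\<close> the variables, as pairs of a block in \<open>B\<close> and a root of unity. A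
  map \<open>\<sigma>\<close> picks a variable from every factor, so the sum is the coefficient,
  after specialisation, of the monomial with exponent \<open>fst b * c b\<close> in each block
  variable \<open>b\<close>. Only choices sending every \<open>s_l\<close> to blocks of its own type
  \<open>l\<close> contribute, and these are counted by multinomial coefficients of
  \<open>p - 1\<close>.\<close>

lemma sum_over_types_nonzero:
  fixes K :: "nat set" and c :: "nat \<times> nat \<Rightarrow> nat"
  assumes pr: "prime CARD('k::{field,finite})" and K: "finite K" "\<And>l. l \<in> K \<Longrightarrow> 0 < l \<and> l < CARD('k)"
    and c: "\<And>l. l \<in> K \<Longrightarrow> (\<Sum>m\<le>l. c (l, m)) = CARD('k) - 1"
  defines "T \<equiv> K \<times> {..<CARD('k) - 1}" and "B \<equiv> (SIGMA l:K. {..l})"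
  defines "I \<equiv> (SIGMA b:B. {z :: 'k alg_closure. z ^ fst b = 1})"
  shows "(\<Sum>\<sigma>\<in>T \<rightarrow>\<^sub>E I. if \<forall>b\<in>B. (\<Sum>\<tau>\<in>{\<tau>\<in>T. fst (\<sigma> \<tau>) = b}. fst \<tau>) = fst b * c b
      then \<Prod>\<tau>\<in>T. snd (\<sigma> \<tau>) ^ fst \<tau> else 0) \<noteq> (0 :: 'k alg_closure)"
proof -
  let ?q = "CARD('k) - 1"
  define P :: "nat \<times> nat \<Rightarrow> nat \<Rightarrow> 'k alg_closure"
    where "P b j = (\<Sum>z | z ^ fst b = 1. z ^ j)" for b j
  define cond where "cond \<beta> \<longleftrightarrow> (\<forall>b\<in>B. (\<Sum>\<tau>\<in>{\<tau>\<in>T. \<beta> \<tau> = b}. fst \<tau>) = fst b * c b)"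
    for \<beta> :: "nat \<times> nat \<Rightarrow> nat \<times> nat"
  have CH: "CHAR('k) = CARD('k)" using CHAR_eq_CARD[OF pr] .
  have nz: "of_nat l \<noteq> (0 :: 'k alg_closure)" if "l \<in> K" for l
    using K(2)[OF that] CH by (auto simp: of_nat_eq_0_iff_char_dvd dest: dvd_imp_le)
  have finT: "finite T" and finB: "finite B" using K by (auto simp: T_def B_def)
  have finI: "finite I"
    unfolding I_def using finB nz K(2) by (intro finite_SigmaI card_roots_of_unity(1)) (auto simp: B_def)
  have Tpos: "0 < fst \<tau>" "fst \<tau> \<in> K" if "\<tau> \<in> T" for \<tau> using that K(2) by (auto simp: T_def)
  have IB: "fst i \<in> B" if "i \<in> I" for i using that by (auto simp: I_def)
  have B_K: "fst b \<in> K" if "b \<in> B" for b using that by (auto simp: B_def)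

  text \<open>Group the maps into \<open>I\<close> by the blocks they hit; within a block the sum factors into
    power sums of roots of unity.\<close>
  have "(\<Sum>\<sigma>\<in>T \<rightarrow>\<^sub>E I. if \<forall>b\<in>B. (\<Sum>\<tau>\<in>{\<tau>\<in>T. fst (\<sigma> \<tau>) = b}. fst \<tau>) = fst b * c b
      then \<Prod>\<tau>\<in>T. snd (\<sigma> \<tau>) ^ fst \<tau> else 0)
    = (\<Sum>\<beta>\<in>T \<rightarrow>\<^sub>E B. \<Sum>\<sigma>\<in>{\<sigma>\<in>T \<rightarrow>\<^sub>E I. (\<lambda>\<tau>\<in>T. fst (\<sigma> \<tau>)) = \<beta>}.
       if \<forall>b\<in>B. (\<Sum>\<tau>\<in>{\<tau>\<in>T. fst (\<sigma> \<tau>) = b}. fst \<tau>) = fst b * c b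
       then \<Prod>\<tau>\<in>T. snd (\<sigma> \<tau>) ^ fst \<tau> else 0)"
    using finT finI finB
    by (intro sum.group[symmetric] finite_PiE) (auto simp: PiE_def Pi_def intro!: IB)
  also have "\<dots> = (\<Sum>\<beta>\<in>T \<rightarrow>\<^sub>E B. if cond \<beta> then \<Prod>\<tau>\<in>T. P (\<beta> \<tau>) (fst \<tau>) else 0)"
  proof (rule sum.cong[OF refl])
    fix \<beta> assume \<beta>: "\<beta> \<in> T \<rightarrow>\<^sub>E B"
    have finZ: "finite {z :: 'k alg_closure. z ^ fst (\<beta> \<tau>) = 1}" if "\<tau> \<in> T" for \<tau>
      using B_K[OF PiE_mem[OF \<beta> that]] nz K(2) by (intro card_roots_of_unity(1)) auto
    have L_eq: "{\<sigma>\<in>T \<rightarrow>\<^sub>E I. (\<lambda>\<tau>\<in>T. fst (\<sigma> \<tau>)) = \<beta>} = (\<Pi>\<^sub>E \<tau>\<in>T. {\<beta> \<tau>} \<times> {z. z ^ fst (\<beta> \<tau>) = 1})" (is "?L = ?R")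
    proof
      show "?L \<subseteq> ?R"
      proof
        fix \<sigma> assume \<sigma>: "\<sigma> \<in> ?L"
        have "\<sigma> \<tau> \<in> {\<beta> \<tau>} \<times> {z. z ^ fst (\<beta> \<tau>) = 1}" if "\<tau> \<in> T" for \<tau>
        proof -
          have "\<sigma> \<tau> \<in> I" "fst (\<sigma> \<tau>) = \<beta> \<tau>" using \<sigma> that by auto
          then show ?thesis by (cases "\<sigma> \<tau>") (auto simp: I_def)
        qed
        then show "\<sigma> \<in> ?R" using \<sigma> by (auto simp: PiE_def)
      qed
      show "?R \<subseteq> ?L"
      proof
        fix \<sigma> assume \<sigma>: "\<sigma> \<in> ?R"
        then have s: "fst (\<sigma> \<tau>) = \<beta> \<tau>" "snd (\<sigma> \<tau>) ^ fst (\<beta> \<tau>) = 1" if "\<tau> \<in> T" for \<tau>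
          using PiE_mem[OF \<sigma> that] by (auto simp: mem_Times_iff)
        have "(\<lambda>\<tau>\<in>T. fst (\<sigma> \<tau>)) = \<beta>"
          using \<beta> s(1) by (auto simp: fun_eq_iff PiE_def extensional_def)
        moreover have "\<sigma> \<tau> \<in> I" if "\<tau> \<in> T" for \<tau>
        proof -
          have "\<beta> \<tau> \<in> B" using \<beta> that by auto
          then show ?thesis using s[OF that] by (cases "\<sigma> \<tau>") (auto simp: I_def)
        qed
        ultimately show "\<sigma> \<in> ?L" using \<sigma> by (auto simp: PiE_def)
      qed
    qed
    have "(\<Sum>\<sigma>\<in>{\<sigma>\<in>T \<rightarrow>\<^sub>E I. (\<lambda>\<tau>\<in>T. fst (\<sigma> \<tau>)) = \<beta>}.
       if \<forall>b\<in>B. (\<Sum>\<tau>\<in>{\<tau>\<in>T. fst (\<sigma> \<tau>) = b}. fst \<tau>) = fst b * c b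
       then \<Prod>\<tau>\<in>T. snd (\<sigma> \<tau>) ^ fst \<tau> else 0)
      = (\<Sum>\<sigma>\<in>{\<sigma>\<in>T \<rightarrow>\<^sub>E I. (\<lambda>\<tau>\<in>T. fst (\<sigma> \<tau>)) = \<beta>}. if cond \<beta> then \<Prod>\<tau>\<in>T. snd (\<sigma> \<tau>) ^ fst \<tau> else 0)"
    proof (rule sum.cong[OF refl])
      fix \<sigma> assume "\<sigma> \<in> {\<sigma>\<in>T \<rightarrow>\<^sub>E I. (\<lambda>\<tau>\<in>T. fst (\<sigma> \<tau>)) = \<beta>}"
      then have "fst (\<sigma> \<tau>) = \<beta> \<tau>" if "\<tau> \<in> T" for \<tau> using that by auto
      then have "{\<tau>\<in>T. fst (\<sigma> \<tau>) = b} = {\<tau>\<in>T. \<beta> \<tau> = b}" for b by auto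
      then show "(if \<forall>b\<in>B. (\<Sum>\<tau>\<in>{\<tau>\<in>T. fst (\<sigma> \<tau>) = b}. fst \<tau>) = fst b * c b
       then \<Prod>\<tau>\<in>T. snd (\<sigma> \<tau>) ^ fst \<tau> else 0) = (if cond \<beta> then \<Prod>\<tau>\<in>T. snd (\<sigma> \<tau>) ^ fst \<tau> else 0)"
        by (simp add: cond_def)
    qed
    also have "\<dots> = (if cond \<beta> then \<Sum>\<sigma>\<in>{\<sigma>\<in>T \<rightarrow>\<^sub>E I. (\<lambda>\<tau>\<in>T. fst (\<sigma> \<tau>)) = \<beta>}. \<Prod>\<tau>\<in>T. snd (\<sigma> \<tau>) ^ fst \<tau> else 0)"
      by simp
    also have "\<dots> = (if cond \<beta> then \<Prod>\<tau>\<in>T. \<Sum>y\<in>{\<beta> \<tau>} \<times> {z. z ^ fst (\<beta> \<tau>) = 1}. snd y ^ fst \<tau> else 0)"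
      unfolding L_eq
      by (intro if_cong refl prod_sum_PiE[symmetric] finite_cartesian_product finT finZ) auto
    also have "\<dots> = (if cond \<beta> then \<Prod>\<tau>\<in>T. P (\<beta> \<tau>) (fst \<tau>) else 0)"
    proof (intro if_cong refl prod.cong)
      fix \<tau>
      have "{\<beta> \<tau>} \<times> {z :: 'k alg_closure. z ^ fst (\<beta> \<tau>) = 1} = Pair (\<beta> \<tau>) ` {z. z ^ fst (\<beta> \<tau>) = 1}" by auto
      then show "(\<Sum>y\<in>{\<beta> \<tau>} \<times> {z. z ^ fst (\<beta> \<tau>) = 1}. snd y ^ fst \<tau>) = P (\<beta> \<tau>) (fst \<tau>)"
        by (simp add: P_def sum.reindex inj_on_def)
    qed
    finally show "(\<Sum>\<sigma>\<in>{\<sigma>\<in>T \<rightarrow>\<^sub>E I. (\<lambda>\<tau>\<in>T. fst (\<sigma> \<tau>)) = \<beta>}.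
       if \<forall>b\<in>B. (\<Sum>\<tau>\<in>{\<tau>\<in>T. fst (\<sigma> \<tau>) = b}. fst \<tau>) = fst b * c b
       then \<Prod>\<tau>\<in>T. snd (\<sigma> \<tau>) ^ fst \<tau> else 0) = (if cond \<beta> then \<Prod>\<tau>\<in>T. P (\<beta> \<tau>) (fst \<tau>) else 0)" .
  qed
  also have "\<dots> = (\<Sum>\<beta>\<in>{\<beta>\<in>T \<rightarrow>\<^sub>E B. cond \<beta> \<and> (\<forall>\<tau>\<in>T. fst (\<beta> \<tau>) = fst \<tau>)}. \<Prod>\<tau>\<in>T. P (\<beta> \<tau>) (fst \<tau>))"
  proof (rule sum.mono_neutral_cong_right)
    show "finite (T \<rightarrow>\<^sub>E B)" using finT finB by (simp add: finite_PiE)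
    show "\<forall>\<beta>\<in>(T \<rightarrow>\<^sub>E B) - {\<beta>\<in>T \<rightarrow>\<^sub>E B. cond \<beta> \<and> (\<forall>\<tau>\<in>T. fst (\<beta> \<tau>) = fst \<tau>)}.
       (if cond \<beta> then \<Prod>\<tau>\<in>T. P (\<beta> \<tau>) (fst \<tau>) else 0) = 0"
    proof (rule ballI, rule ccontr)
      fix \<beta> assume \<beta>: "\<beta> \<in> (T \<rightarrow>\<^sub>E B) - {\<beta>\<in>T \<rightarrow>\<^sub>E B. cond \<beta> \<and> (\<forall>\<tau>\<in>T. fst (\<beta> \<tau>) = fst \<tau>)}"
        and ne: "(if cond \<beta> then \<Prod>\<tau>\<in>T. P (\<beta> \<tau>) (fst \<tau>) else 0) \<noteq> 0"
      then have cond: "cond \<beta>" and ne': "\<And>\<tau>. \<tau> \<in> T \<Longrightarrow> P (\<beta> \<tau>) (fst \<tau>) \<noteq> 0"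
        using finT by (auto split: if_splits)
      have \<beta>B: "\<beta> \<tau> \<in> B" if "\<tau> \<in> T" for \<tau> using \<beta> that by auto
      \<comment> \<open>A block whose type exceeds the degree of the factor contributes a vanishing
        power sum of roots of unity.\<close>
      have le: "fst (\<beta> \<tau>) \<le> fst \<tau>" if "\<tau> \<in> T" for \<tau>
      proof (rule ccontr)
        assume "\<not> fst (\<beta> \<tau>) \<le> fst \<tau>"
        then have "P (\<beta> \<tau>) (fst \<tau>) = 0"
          unfolding P_def using Tpos[OF that] B_K[OF \<beta>B[OF that]] nz K(2)
          by (intro power_sum_roots_of_unity) auto
        then show False using ne'[OF that] by simp
      qed
      text \<open>Weighting every factor by its degree, the block capacities force equality of types.\<close>
      have "(\<Sum>\<tau>\<in>T. fst \<tau> * fst (\<beta> \<tau>)) = (\<Sum>b\<in>B. \<Sum>\<tau>\<in>{\<tau>\<in>T. \<beta> \<tau> = b}. fst \<tau> * fst (\<beta> \<tau>))"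
        using finT finB \<beta>B by (intro sum.group[symmetric]) auto
      also have "\<dots> = (\<Sum>b\<in>B. fst b * (fst b * c b))"
      proof (rule sum.cong[OF refl])
        fix b assume "b \<in> B"
        have "(\<Sum>\<tau>\<in>{\<tau>\<in>T. \<beta> \<tau> = b}. fst \<tau> * fst (\<beta> \<tau>)) = (\<Sum>\<tau>\<in>{\<tau>\<in>T. \<beta> \<tau> = b}. fst \<tau>) * fst b"
          unfolding sum_distrib_right by (intro sum.cong) auto
        then show "(\<Sum>\<tau>\<in>{\<tau>\<in>T. \<beta> \<tau> = b}. fst \<tau> * fst (\<beta> \<tau>)) = fst b * (fst b * c b)"
          using cond \<open>b \<in> B\<close> by (simp add: cond_def)
      qed
      also have "\<dots> = (\<Sum>l\<in>K. \<Sum>m\<le>l. l * (l * c (l, m)))"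
        unfolding B_def using K by (subst sum.Sigma) (auto intro: sum.cong)
      also have "\<dots> = (\<Sum>l\<in>K. l * l * ?q)"
        using c by (intro sum.cong) (auto simp flip: sum_distrib_left)
      also have "\<dots> = (\<Sum>\<tau>\<in>T. fst \<tau> * fst \<tau>)"
        unfolding T_def sum.cartesian_product' by (simp add: mult_ac)
      finally have eq: "(\<Sum>\<tau>\<in>T. fst \<tau> * fst (\<beta> \<tau>)) = (\<Sum>\<tau>\<in>T. fst \<tau> * fst \<tau>)" .
      have "fst (\<beta> \<tau>) = fst \<tau>" if "\<tau> \<in> T" for \<tau>
      proof (rule ccontr)
        assume "fst (\<beta> \<tau>) \<noteq> fst \<tau>"
        then have "fst \<tau> * fst (\<beta> \<tau>) < fst \<tau> * fst \<tau>"
          using le[OF that] Tpos[OF that] by simp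
        then have "(\<Sum>\<tau>\<in>T. fst \<tau> * fst (\<beta> \<tau>)) < (\<Sum>\<tau>\<in>T. fst \<tau> * fst \<tau>)"
          using finT le that by (intro sum_strict_mono_ex1) auto
        then show False using eq by simp
      qed
      then show False using \<beta> cond by auto
    qed
  qed auto
  \<comment> \<open>For matching types every summand \<open>z ^ l\<close> is 1, so the power sum is
    the number \<open>l\<close> of roots of unity.\<close>
  also have "\<dots> = (\<Sum>\<beta>\<in>{\<beta>\<in>T \<rightarrow>\<^sub>E B. cond \<beta> \<and> (\<forall>\<tau>\<in>T. fst (\<beta> \<tau>) = fst \<tau>)}. \<Prod>\<tau>\<in>T. of_nat (fst \<tau>))"
  proof (intro sum.cong prod.cong refl)
    fix \<beta> \<tau> assume "\<beta> \<in> {\<beta>\<in>T \<rightarrow>\<^sub>E B. cond \<beta> \<and> (\<forall>\<tau>\<in>T. fst (\<beta> \<tau>) = fst \<tau>)}" and \<tau>: "\<tau> \<in> T"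
    then have "fst (\<beta> \<tau>) = fst \<tau>" by auto
    then have "P (\<beta> \<tau>) (fst \<tau>) = (\<Sum>z :: 'k alg_closure | z ^ fst \<tau> = 1. 1)"
      unfolding P_def by (intro sum.cong) auto
    then show "P (\<beta> \<tau>) (fst \<tau>) = of_nat (fst \<tau>)"
      using card_roots_of_unity(2)[OF Tpos(1)[OF \<tau>] nz[OF Tpos(2)[OF \<tau>]]] by simp
  qed
  also have "\<dots> = of_nat (card {\<beta>\<in>T \<rightarrow>\<^sub>E B. cond \<beta> \<and> (\<forall>\<tau>\<in>T. fst (\<beta> \<tau>) = fst \<tau>)}) * (\<Prod>\<tau>\<in>T. of_nat (fst \<tau>))"
    by simp
  also have "{\<beta>\<in>T \<rightarrow>\<^sub>E B. cond \<beta> \<and> (\<forall>\<tau>\<in>T. fst (\<beta> \<tau>) = fst \<tau>)}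
      = {\<beta>\<in>T \<rightarrow>\<^sub>E B. (\<forall>b\<in>B. card {\<tau>\<in>T. \<beta> \<tau> = b} = c b) \<and> (\<forall>\<tau>\<in>T. fst (\<beta> \<tau>) = fst \<tau>)}" (is "_ = ?\<Omega>")
  proof -
    \<comment> \<open>All factors sent to \<open>b\<close> now have degree \<open>fst b\<close>,
      which is positive and cancels, so the capacity condition becomes a count of factors.\<close>
    have "cond \<beta> \<longleftrightarrow> (\<forall>b\<in>B. card {\<tau>\<in>T. \<beta> \<tau> = b} = c b)" if "\<forall>\<tau>\<in>T. fst (\<beta> \<tau>) = fst \<tau>" for \<beta>
      unfolding cond_def
    proof (rule ball_cong[OF refl])
      fix b assume "b \<in> B"
      have "(\<Sum>\<tau>\<in>{\<tau>\<in>T. \<beta> \<tau> = b}. fst \<tau>) = (\<Sum>\<tau>\<in>{\<tau>\<in>T. \<beta> \<tau> = b}. fst b)"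
        using that by (intro sum.cong) auto
      then show "((\<Sum>\<tau>\<in>{\<tau>\<in>T. \<beta> \<tau> = b}. fst \<tau>) = fst b * c b) = (card {\<tau>\<in>T. \<beta> \<tau> = b} = c b)"
        using K(2)[OF B_K[OF \<open>b \<in> B\<close>]] by auto
    qed
    then show ?thesis by auto
  qed
  \<comment> \<open>A type preserving map amounts to independent maps, one for each
    \<open>l\<close>, from the \<open>p - 1\<close> copies of \<open>s_l\<close> to the
    \<open>l + 1\<close> blocks of type \<open>l\<close>.\<close>
  also have "card ?\<Omega> = (\<Prod>l\<in>K. card {f \<in> {..<?q} \<rightarrow>\<^sub>E {..l}. \<forall>m\<in>{..l}. card {t\<in>{..<?q}. f t = m} = c (l, m)})"
    (is "_ = (\<Prod>l\<in>K. card (?\<Gamma> l))")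
  proof -
    have "bij_betw (\<lambda>\<beta>. \<lambda>l\<in>K. \<lambda>t\<in>{..<?q}. snd (\<beta> (l, t))) ?\<Omega> (Pi\<^sub>E K ?\<Gamma>)"
    proof (rule bij_betw_byWitness[where f' = "\<lambda>\<gamma>. \<lambda>\<tau>\<in>T. (fst \<tau>, \<gamma> (fst \<tau>) (snd \<tau>))"])
      show "\<forall>\<beta>\<in>?\<Omega>. (\<lambda>\<tau>\<in>T. (fst \<tau>, (\<lambda>l\<in>K. \<lambda>t\<in>{..<?q}. snd (\<beta> (l, t))) (fst \<tau>) (snd \<tau>))) = \<beta>"
      proof
        fix \<beta> assume \<beta>: "\<beta> \<in> ?\<Omega>"
        show "(\<lambda>\<tau>\<in>T. (fst \<tau>, (\<lambda>l\<in>K. \<lambda>t\<in>{..<?q}. snd (\<beta> (l, t))) (fst \<tau>) (snd \<tau>))) = \<beta>"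
        proof
          fix \<tau>
          show "(\<lambda>\<tau>\<in>T. (fst \<tau>, (\<lambda>l\<in>K. \<lambda>t\<in>{..<?q}. snd (\<beta> (l, t))) (fst \<tau>) (snd \<tau>))) \<tau> = \<beta> \<tau>"
          proof (cases "\<tau> \<in> T")
            case True
            then have "fst (\<beta> \<tau>) = fst \<tau>" using \<beta> by auto
            then have "\<beta> \<tau> = (fst \<tau>, snd (\<beta> \<tau>))" by (metis prod.collapse)
            then show ?thesis using True by (auto simp: T_def)
          next
            case False
            moreover have "\<beta> \<in> T \<rightarrow>\<^sub>E B" using \<beta> by blast
            ultimately have "\<beta> \<tau> = undefined" using PiE_arb by metis
            then show ?thesis using False by simp
          qed
        qed
      qed
      show "\<forall>\<gamma>\<in>Pi\<^sub>E K ?\<Gamma>. (\<lambda>l\<in>K. \<lambda>t\<in>{..<?q}. snd ((\<lambda>\<tau>\<in>T. (fst \<tau>, \<gamma> (fst \<tau>) (snd \<tau>))) (l, t))) = \<gamma>"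
      proof
        fix \<gamma> assume \<gamma>: "\<gamma> \<in> Pi\<^sub>E K ?\<Gamma>"
        show "(\<lambda>l\<in>K. \<lambda>t\<in>{..<?q}. snd ((\<lambda>\<tau>\<in>T. (fst \<tau>, \<gamma> (fst \<tau>) (snd \<tau>))) (l, t))) = \<gamma>"
        proof (rule ext, rule ext)
          fix l t
          have "\<gamma> l = undefined" if "l \<notin> K" using \<gamma> that by (auto simp: PiE_def extensional_def)
          moreover have "\<gamma> l t = undefined" if "l \<in> K" "t \<notin> {..<?q}"
          proof -
            have "\<gamma> l \<in> {..<?q} \<rightarrow>\<^sub>E {..l}" using \<gamma> that by auto
            then show ?thesis using that by (auto simp: PiE_def extensional_def)
          qed
          ultimately show "(\<lambda>l\<in>K. \<lambda>t\<in>{..<?q}. snd ((\<lambda>\<tau>\<in>T. (fst \<tau>, \<gamma> (fst \<tau>) (snd \<tau>))) (l, t))) l t = \<gamma> l t"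
            by (auto simp: T_def)
        qed
      qed
      show "(\<lambda>\<beta>. \<lambda>l\<in>K. \<lambda>t\<in>{..<?q}. snd (\<beta> (l, t))) ` ?\<Omega> \<subseteq> Pi\<^sub>E K ?\<Gamma>"
      proof (rule image_subsetI)
        fix \<beta> assume \<beta>: "\<beta> \<in> ?\<Omega>"
        have "(\<lambda>t\<in>{..<?q}. snd (\<beta> (l, t))) \<in> ?\<Gamma> l" if l: "l \<in> K" for l
        proof -
          have b: "\<beta> (l, t) \<in> B \<and> fst (\<beta> (l, t)) = l" if "t < ?q" for t
            using \<beta> l that by (auto simp: T_def PiE_def Pi_def)
          have ran: "snd (\<beta> (l, t)) \<le> l" if "t < ?q" for t
            using b[OF that] by (auto simp: B_def)
          have "card {t\<in>{..<?q}. snd (\<beta> (l, t)) = m} = c (l, m)" if "m \<le> l" for m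
          proof -
            have "{\<tau>\<in>T. \<beta> \<tau> = (l, m)} = Pair l ` {t\<in>{..<?q}. snd (\<beta> (l, t)) = m}"
            proof
              show "{\<tau>\<in>T. \<beta> \<tau> = (l, m)} \<subseteq> Pair l ` {t\<in>{..<?q}. snd (\<beta> (l, t)) = m}"
              proof
                fix \<tau> assume \<tau>: "\<tau> \<in> {\<tau>\<in>T. \<beta> \<tau> = (l, m)}"
                then have "fst \<tau> = l" using \<beta> by force
                then have "\<tau> = (l, snd \<tau>)" by auto
                then show "\<tau> \<in> Pair l ` {t\<in>{..<?q}. snd (\<beta> (l, t)) = m}"
                  using \<tau> by (auto simp: T_def intro!: image_eqI[of _ _ "snd \<tau>"])
              qed
              show "Pair l ` {t\<in>{..<?q}. snd (\<beta> (l, t)) = m} \<subseteq> {\<tau>\<in>T. \<beta> \<tau> = (l, m)}"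
                using b l by (auto simp: T_def prod_eq_iff)
            qed
            moreover have "card {\<tau>\<in>T. \<beta> \<tau> = (l, m)} = c (l, m)"
              using \<beta> l that by (auto simp: B_def)
            ultimately show ?thesis by (simp add: card_image inj_on_def)
          qed
          then show ?thesis using ran by (auto cong: conj_cong)
        qed
        then show "(\<lambda>l\<in>K. \<lambda>t\<in>{..<?q}. snd (\<beta> (l, t))) \<in> Pi\<^sub>E K ?\<Gamma>" by auto
      qed
      show "(\<lambda>\<gamma>. \<lambda>\<tau>\<in>T. (fst \<tau>, \<gamma> (fst \<tau>) (snd \<tau>))) ` Pi\<^sub>E K ?\<Gamma> \<subseteq> ?\<Omega>"
      proof (rule image_subsetI)
        fix \<gamma> assume \<gamma>: "\<gamma> \<in> Pi\<^sub>E K ?\<Gamma>"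
        then have g: "\<gamma> l \<in> {..<?q} \<rightarrow>\<^sub>E {..l}" "\<And>m. m \<le> l \<Longrightarrow> card {t\<in>{..<?q}. \<gamma> l t = m} = c (l, m)" if "l \<in> K" for l
          using that by auto
        let ?b = "\<lambda>\<tau>\<in>T. (fst \<tau>, \<gamma> (fst \<tau>) (snd \<tau>))"
        have "?b \<in> T \<rightarrow>\<^sub>E B"
          using g(1) by (auto simp: T_def B_def PiE_def Pi_def)
        moreover have "card {\<tau>\<in>T. ?b \<tau> = b} = c b" if bB: "b \<in> B" for b
        proof -
          obtain l m where b: "b = (l, m)" "l \<in> K" "m \<le> l" using bB by (auto simp: B_def)
          have "{\<tau>\<in>T. ?b \<tau> = b} = Pair l ` {t\<in>{..<?q}. \<gamma> l t = m}"
            using b by (auto simp: T_def)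
          then show ?thesis using g(2)[OF b(2,3)] b(1) by (simp add: card_image inj_on_def)
        qed
        ultimately show "?b \<in> ?\<Omega>" by simp
      qed
    qed
    then show ?thesis using K by (simp add: bij_betw_same_card card_PiE)
  qed
  finally have sum_eq: "(\<Sum>\<sigma>\<in>T \<rightarrow>\<^sub>E I. if \<forall>b\<in>B. (\<Sum>\<tau>\<in>{\<tau>\<in>T. fst (\<sigma> \<tau>) = b}. fst \<tau>) = fst b * c b
      then \<Prod>\<tau>\<in>T. snd (\<sigma> \<tau>) ^ fst \<tau> else 0)
     = of_nat (\<Prod>l\<in>K. card (?\<Gamma> l)) * (\<Prod>\<tau>\<in>T. of_nat (fst \<tau>))" .
  \<comment> \<open>The multinomial coefficient divides \<open>fact (CARD('k) - 1)\<close>, a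
    product of numbers below the prime.\<close>
  have "\<not> CARD('k) dvd card (?\<Gamma> l)" if l: "l \<in> K" for l
  proof
    assume "CARD('k) dvd card (?\<Gamma> l)"
    then have "CARD('k) dvd card (?\<Gamma> l) * (\<Prod>m\<in>{..l}. fact (c (l, m)))" by (rule dvd_mult2)
    also have "card (?\<Gamma> l) * (\<Prod>m\<in>{..l}. fact (c (l, m))) = fact ?q"
      using card_maps_with_fibre_sizes[of "{..l}" "{..<?q}" "\<lambda>m. c (l, m)"] c[OF l] by simp
    finally show False
      using pr prime_dvd_fact_iff[OF pr, of ?q] prime_gt_0_nat[OF pr] by simp
  qed
  then have "\<not> CARD('k) dvd (\<Prod>l\<in>K. card (?\<Gamma> l))"
    unfolding prime_dvd_prod_iff[OF K(1) pr] by blast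
  then have "of_nat (\<Prod>l\<in>K. card (?\<Gamma> l)) \<noteq> (0 :: 'k alg_closure)"
    unfolding of_nat_eq_0_iff_char_dvd CHAR_alg_closure CH .
  moreover have "(\<Prod>\<tau>\<in>T. of_nat (fst \<tau>)) \<noteq> (0 :: 'k alg_closure)"
    using finT nz Tpos(2) by simp
  ultimately show ?thesis unfolding sum_eq by (rule no_zero_divisors)
qed

lemma prod_power_fibres:
  fixes w :: "'t \<Rightarrow> nat"
  assumes "finite T" "finite I" "\<sigma> \<in> T \<rightarrow>\<^sub>E I"
  shows "(\<Prod>\<tau>\<in>T. g (\<sigma> \<tau>) ^ w \<tau>) = (\<Prod>i\<in>I. (g i :: 'a::comm_monoid_mult) ^ (\<Sum>\<tau>\<in>{\<tau>\<in>T. \<sigma> \<tau> = i}. w \<tau>))"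
proof -
  have "(\<Prod>\<tau>\<in>T. g (\<sigma> \<tau>) ^ w \<tau>) = (\<Prod>i\<in>I. \<Prod>\<tau>\<in>{\<tau>\<in>T. \<sigma> \<tau> = i}. g (\<sigma> \<tau>) ^ w \<tau>)"
    using assms by (intro prod.group[symmetric]) auto
  also have "\<dots> = (\<Prod>i\<in>I. \<Prod>\<tau>\<in>{\<tau>\<in>T. \<sigma> \<tau> = i}. g i ^ w \<tau>)"
    by (intro prod.cong) auto
  finally show ?thesis by (simp add: power_sum)
qed

text \<open>The function \<open>P\<close> below vanishes at every non-solution. Its leading form is,
  up to sign, the product of the \<open>s_l ^ (p - 1)\<close>, and \<open>coeff_functional\<close>
  sends this to a nonzero value. As the functional is a weighted sum of values, \<open>P\<close> is
  nonzero somewhere.\<close>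

lemma power_sum_system_solvable:
  fixes f :: "nat \<Rightarrow> 'k::{field,finite} poly" and y :: "nat \<Rightarrow> 'k"
  assumes pr: "prime CARD('k)" and K: "finite K" "\<And>l. l \<in> K \<Longrightarrow> 0 < l \<and> l * l < CARD('k)"
    and f: "\<And>l. l \<in> K \<Longrightarrow> degree (f l) = l \<and> lead_coeff (f l) = 1"
  shows "\<exists>x :: nat \<Rightarrow> 'k. \<forall>l\<in>K. (\<Sum>i<(\<Sum>l\<in>K. l * (l + 1)). poly (f l) (x i)) = y l"
proof -
  define q where "q = CARD('k) - 1"
  \<comment> \<open>The last block of type \<open>l\<close> takes the remainder of \<open>q\<close>
    modulo \<open>l\<close>, each of the other \<open>l\<close> blocks the quotient, so the
    capacities add up to \<open>q\<close>. Measured in degrees every block holds at most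
    \<open>q\<close>; for the last one this follows from \<open>q mod l < l\<close> and
    \<open>l * l < CARD('k)\<close>.\<close>
  define c where "c b = (if snd b < fst b then q div fst b else q mod fst b)" for b :: "nat \<times> nat"
  define T where "T = K \<times> {..<q}"
  define B where "B = (SIGMA l:K. {..l})"
  define I where "I = (SIGMA b:B. {z :: 'k alg_closure. z ^ fst b = 1})"
  have q0: "q > 0" using card_mono[of "UNIV :: 'k set" "{0, 1}"] by (simp add: q_def)
  have Klt: "0 < l \<and> l < CARD('k)" if "l \<in> K" for l
  proof -
    have "l \<le> l * l" using K(2)[OF that] by simp
    then show ?thesis using K(2)[OF that] by linarith
  qed
  have nz: "of_nat l \<noteq> (0 :: 'k alg_closure)" if "l \<in> K" for l
    using Klt[OF that] CHAR_eq_CARD[OF pr] by (auto simp: of_nat_eq_0_iff_char_dvd dest: dvd_imp_le)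
  have csum: "(\<Sum>m\<le>l. c (l, m)) = q" for l
  proof -
    have "(\<Sum>m\<le>l. c (l, m)) = (\<Sum>m<l. c (l, m)) + c (l, l)"
      by (simp add: lessThan_Suc_atMost[symmetric])
    then show ?thesis by (simp add: c_def)
  qed
  have cle: "fst b * c b \<le> q" if "b \<in> B" for b
  proof (cases "snd b < fst b")
    case True
    then show ?thesis by (simp add: c_def)
  next
    case False
    have l: "0 < fst b" "fst b * fst b < CARD('k)" using that K(2) by (auto simp: B_def)
    then have "q mod fst b \<le> fst b" by (simp add: less_imp_le)
    then have "fst b * c b \<le> fst b * fst b" using False by (simp add: c_def)
    then show ?thesis using l(2) unfolding q_def by linarith
  qed
  have finT: "finite T" and finB: "finite B" using K by (auto simp: T_def B_def)
  have Z: "finite {z :: 'k alg_closure. z ^ fst b = 1}" "card {z :: 'k alg_closure. z ^ fst b = 1} = fst b" if "b \<in> B" for b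
    using that nz K(2) by (auto intro!: card_roots_of_unity simp: B_def)
  have finI: "finite I" unfolding I_def using finB Z by auto
  have cardI: "card I = (\<Sum>l\<in>K. l * (l + 1))"
  proof -
    have "card I = (\<Sum>b\<in>B. fst b)" unfolding I_def using finB Z by (simp add: card_SigmaI)
    also have "\<dots> = (\<Sum>l\<in>K. \<Sum>m\<le>l. l)" unfolding B_def using K by (subst sum.Sigma) (auto intro: sum.cong)
    finally show ?thesis by (simp add: mult.commute)
  qed
  \<comment> \<open>These exponent vectors yield the monomial with exponents
    \<open>fst b * c b\<close> once variable \<open>(b, z)\<close> is replaced by \<open>z\<close>
    times the variable of block \<open>b\<close>. The weights \<open>snd\<close> of the functional
    supply the factors \<open>z\<close>.\<close>
  define S where "S = {\<epsilon> \<in> I \<rightarrow>\<^sub>E {..q}. \<forall>b\<in>B. (\<Sum>z | z ^ fst b = 1. \<epsilon> (b, z)) = fst b * c b}"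
  define N where "N = (\<Sum>l\<in>K. l * q)"
  have Ssub: "S \<subseteq> I \<rightarrow>\<^sub>E {..CARD('k) - 1}" by (auto simp: S_def q_def)
  have SN: "sum \<epsilon> I = N" if "\<epsilon> \<in> S" for \<epsilon>
  proof -
    have "sum \<epsilon> I = (\<Sum>b\<in>B. \<Sum>z | z ^ fst b = 1. \<epsilon> (b, z))"
      unfolding I_def using finB Z by (subst sum.Sigma) auto
    also have "\<dots> = (\<Sum>b\<in>B. fst b * c b)" using that by (intro sum.cong) (auto simp: S_def)
    also have "\<dots> = (\<Sum>l\<in>K. \<Sum>m\<le>l. l * c (l, m))"
      unfolding B_def using K by (subst sum.Sigma) (auto intro: sum.cong)
    also have "\<dots> = N" unfolding N_def using csum by (simp flip: sum_distrib_left)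
    finally show ?thesis .
  qed
  let ?L = "coeff_functional I S snd"
  define s where "s l x = (\<Sum>i\<in>I. to_ac (x i) ^ l)" for l and x :: "_ \<Rightarrow> 'k"
  define P where "P x = (\<Prod>l\<in>K. 1 - to_ac ((\<Sum>i\<in>I. poly (f l) (x i)) - y l) ^ q)" for x

  \<comment> \<open>The constants \<open>y l\<close>, the lower coefficients of the monic
    \<open>f l\<close> and the summand 1 all disappear from the leading form, since \<open>l\<close>
    and \<open>q\<close> are positive.\<close>
  have top: "same_top I N P (\<lambda>x. \<Prod>l\<in>K. - (s l x ^ q))"
    unfolding P_def N_def
  proof (rule same_top_prod[OF K(1)])
    fix l assume l: "l \<in> K"
    have "same_top I l (\<lambda>x. (\<Sum>i\<in>I. to_ac (poly (f l) (x i))) + to_ac (- y l)) (s l)"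
      unfolding s_def using f[OF l] finI K(2)[OF l]
      by (intro same_top_add_const same_top_sum same_top_poly) auto
    then have "same_top I (\<Sum>t<q. l) (\<lambda>x. \<Prod>t<q. to_ac ((\<Sum>i\<in>I. poly (f l) (x i)) - y l)) (\<lambda>x. \<Prod>t<q. s l x)"
      by (intro same_top_prod) (simp_all add: to_ac_sum)
    then have "same_top I (l * q) (\<lambda>x. to_ac ((\<Sum>i\<in>I. poly (f l) (x i)) - y l) ^ q) (\<lambda>x. s l x ^ q)"
      by (simp add: mult.commute)
    then have "same_top I (l * q) (\<lambda>x. - (to_ac ((\<Sum>i\<in>I. poly (f l) (x i)) - y l) ^ q) + 1) (\<lambda>x. - (s l x ^ q))"
      using K(2)[OF l] q0 by (intro same_top_add_const same_top_uminus) auto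
    then show "same_top I (l * q) (\<lambda>x. 1 - to_ac ((\<Sum>i\<in>I. poly (f l) (x i)) - y l) ^ q) (\<lambda>x. - (s l x ^ q))"
      by (simp add: algebra_simps)
  qed
  \<comment> \<open>The exponent vector of the monomial obtained by picking variable
    \<open>\<sigma> \<tau>\<close> from each factor \<open>\<tau>\<close>.\<close>
  define e where "e \<sigma> i = (\<Sum>\<tau>\<in>{\<tau>\<in>T. \<sigma> \<tau> = i}. fst \<tau>)" for \<sigma> :: "nat \<times> nat \<Rightarrow> (nat \<times> nat) \<times> 'k alg_closure" and i
  have expand: "(\<Prod>l\<in>K. s l x ^ q) = (\<Sum>\<sigma>\<in>T \<rightarrow>\<^sub>E I. monom_fun I (e \<sigma>) x)" for x
  proof -
    have "(\<Prod>l\<in>K. s l x ^ q) = (\<Prod>\<tau>\<in>T. s (fst \<tau>) x)"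
      unfolding T_def prod.cartesian_product' by simp
    also have "\<dots> = (\<Sum>\<sigma>\<in>T \<rightarrow>\<^sub>E I. \<Prod>\<tau>\<in>T. to_ac (x (\<sigma> \<tau>)) ^ fst \<tau>)"
      unfolding s_def using finT finI by (intro prod_sum_PiE) auto
    also have "\<dots> = (\<Sum>\<sigma>\<in>T \<rightarrow>\<^sub>E I. monom_fun I (e \<sigma>) x)"
      unfolding monom_fun_def e_def
      by (intro sum.cong refl prod_power_fibres[OF finT finI, of _ "\<lambda>i. to_ac (x i)"])
    finally show ?thesis .
  qed
  have val: "?L (monom_fun I (e \<sigma>)) = (if \<forall>b\<in>B. (\<Sum>\<tau>\<in>{\<tau>\<in>T. fst (\<sigma> \<tau>) = b}. fst \<tau>) = fst b * c b
      then \<Prod>\<tau>\<in>T. snd (\<sigma> \<tau>) ^ fst \<tau> else 0)" if \<sigma>: "\<sigma> \<in> T \<rightarrow>\<^sub>E I" for \<sigma>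
  proof -
    have "sum (e \<sigma>) I = (\<Sum>\<tau>\<in>T. fst \<tau>)"
      unfolding e_def using finT finI \<sigma> by (intro sum.group) auto
    also have "\<dots> = N" unfolding T_def sum.cartesian_product' N_def by (simp add: mult.commute)
    finally have eN: "sum (e \<sigma>) I = N" .
    have blk: "(\<Sum>z | z ^ fst b = 1. e \<sigma> (b, z)) = (\<Sum>\<tau>\<in>{\<tau>\<in>T. fst (\<sigma> \<tau>) = b}. fst \<tau>)" if b: "b \<in> B" for b
    proof -
      have "(\<Sum>\<tau>\<in>{\<tau>\<in>T. fst (\<sigma> \<tau>) = b}. fst \<tau>) =
         (\<Sum>z | z ^ fst b = 1. \<Sum>\<tau>\<in>{\<tau>\<in>{\<tau>\<in>T. fst (\<sigma> \<tau>) = b}. snd (\<sigma> \<tau>) = z}. fst \<tau>)"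
      proof (rule sum.group[symmetric])
        show "(\<lambda>\<tau>. snd (\<sigma> \<tau>)) ` {\<tau>\<in>T. fst (\<sigma> \<tau>) = b} \<subseteq> {z. z ^ fst b = 1}"
        proof (rule image_subsetI)
          fix \<tau> assume \<tau>: "\<tau> \<in> {\<tau>\<in>T. fst (\<sigma> \<tau>) = b}"
          then have "\<sigma> \<tau> \<in> I" using PiE_mem[OF \<sigma>] by blast
          then show "snd (\<sigma> \<tau>) \<in> {z. z ^ fst b = 1}" using \<tau> by (cases "\<sigma> \<tau>") (auto simp: I_def)
        qed
      qed (use finT Z[OF b] in auto)
      also have "\<dots> = (\<Sum>z | z ^ fst b = 1. e \<sigma> (b, z))"
        unfolding e_def by (intro sum.cong refl) (auto simp: prod_eq_iff)
      finally show ?thesis by simp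
    qed
    have "restrict (e \<sigma>) I \<in> S \<longleftrightarrow> (\<forall>b\<in>B. (\<Sum>\<tau>\<in>{\<tau>\<in>T. fst (\<sigma> \<tau>) = b}. fst \<tau>) = fst b * c b)" (is "_ \<longleftrightarrow> ?C")
    proof -
      have r: "(\<Sum>z | z ^ fst b = 1. restrict (e \<sigma>) I (b, z)) = (\<Sum>z | z ^ fst b = 1. e \<sigma> (b, z))" if "b \<in> B" for b
        using that by (intro sum.cong) (auto simp: I_def)
      \<comment> \<open>The bound on single exponents follows from the block totals: each exponent
        is at most \<open>fst b * c b\<close>, hence at most \<open>q\<close>.\<close>
      have "restrict (e \<sigma>) I \<in> I \<rightarrow>\<^sub>E {..q}" if ?C
      proof -
        have "e \<sigma> i \<le> q" if "i \<in> I" for i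
        proof -
          obtain b z where i: "i = (b, z)" "b \<in> B" "z ^ fst b = 1" using \<open>i \<in> I\<close> by (auto simp: I_def)
          have "e \<sigma> (b, z) \<le> (\<Sum>z | z ^ fst b = 1. e \<sigma> (b, z))"
            using i Z[OF i(2)] by (intro member_le_sum) auto
          also have "\<dots> = fst b * c b" using blk[OF i(2)] \<open>?C\<close> i(2) by simp
          finally show ?thesis using cle[OF i(2)] i(1) by simp
        qed
        then show ?thesis by auto
      qed
      then show ?thesis using r blk by (auto simp: S_def)
    qed
    moreover have "?L (monom_fun I (e \<sigma>)) = (if restrict (e \<sigma>) I \<in> S then \<Prod>i\<in>I. snd i ^ e \<sigma> i else 0)"
      by (rule coeff_functional_monom_top[OF finI Ssub _ eN]) (rule SN)
    ultimately show ?thesis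
      by (simp only: prod_power_fibres[OF finT finI \<sigma>] e_def)
  qed
  have L_top: "?L (\<lambda>x. \<Prod>l\<in>K. - (s l x ^ q)) = (- 1) ^ card K * (\<Sum>\<sigma>\<in>T \<rightarrow>\<^sub>E I. ?L (monom_fun I (e \<sigma>)))"
    unfolding prod_uminus expand coeff_functional_cmult coeff_functional_sum ..
  have "(\<Sum>\<sigma>\<in>T \<rightarrow>\<^sub>E I. ?L (monom_fun I (e \<sigma>))) \<noteq> 0"
  proof -
    have "(\<Sum>\<sigma>\<in>T \<rightarrow>\<^sub>E I. if \<forall>b\<in>B. (\<Sum>\<tau>\<in>{\<tau>\<in>T. fst (\<sigma> \<tau>) = b}. fst \<tau>) = fst b * c b
      then \<Prod>\<tau>\<in>T. snd (\<sigma> \<tau>) ^ fst \<tau> else 0) \<noteq> (0 :: 'k alg_closure)"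
      unfolding T_def B_def I_def q_def
      by (rule sum_over_types_nonzero[OF pr K(1)]) (use Klt csum in \<open>auto simp: q_def\<close>)
    then show ?thesis by (simp add: val cong: sum.cong)
  qed
  then have "?L (\<lambda>x. \<Prod>l\<in>K. - (s l x ^ q)) \<noteq> 0" unfolding L_top by simp
  moreover have "?L P = ?L (\<lambda>x. \<Prod>l\<in>K. - (s l x ^ q))"
    by (rule coeff_functional_same_top[OF finI Ssub _ top]) (rule SN)
  ultimately have "?L P \<noteq> 0" by simp
  then obtain x where x: "P x \<noteq> 0"
    unfolding coeff_functional_def by (metis (mono_tags, lifting) mult_zero_right sum.neutral)
  have sol: "(\<Sum>i\<in>I. poly (f l) (x i)) = y l" if "l \<in> K" for l
  proof (rule ccontr)
    assume "(\<Sum>i\<in>I. poly (f l) (x i)) \<noteq> y l"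
    then have "((\<Sum>i\<in>I. poly (f l) (x i)) - y l) ^ q = 1"
      unfolding q_def by (intro nonzero_power_card) simp
    then have "1 - to_ac ((\<Sum>i\<in>I. poly (f l) (x i)) - y l) ^ q = 0"
      by (metis diff_self to_ac_1 to_ac_power)
    then have "P x = 0" unfolding P_def using K(1) that by (intro prod_zero) auto
    then show False using x by simp
  qed
  obtain h where h: "bij_betw h {..<card I} I"
    using ex_bij_betw_nat_finite[OF finI] by (auto simp: atLeast0LessThan)
  have "(\<Sum>i<card I. poly (f l) (x (h i))) = y l" if "l \<in> K" for l
    using sum.reindex_bij_betw[OF h, of "\<lambda>i. poly (f l) (x i)"] sol[OF that] by simp
  then show ?thesis unfolding cardI by (intro exI[of _ "\<lambda>i. x (h i)"]) auto
qed

section \<open>Sumsets and polynomial curves\<close>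

lemma sumset_add:
  assumes "x \<in> sumset m D" "y \<in> sumset n D"
  shows "x + y \<in> sumset (m + n) D"
  using assms(1)
proof (induction m arbitrary: x)
  case 0
  then show ?case using assms(2) by simp
next
  case (Suc m)
  then obtain a b where "x = a + b" "a \<in> D" "b \<in> sumset m D" by auto
  with Suc.IH[of b] show ?case by (auto simp: add.assoc)
qed

lemma zero_in_sumset: "0 \<in> D \<Longrightarrow> 0 \<in> sumset n D"
  by (induction n) force+

lemma sumset_mono:
  assumes "0 \<in> D" "m \<le> n"
  shows "sumset m D \<subseteq> sumset n D"
proof
  fix x assume "x \<in> sumset m D"
  from sumset_add[OF this zero_in_sumset[OF assms(1)], of "n - m"] show "x \<in> sumset n D"
    using assms(2) by simp
qed

lemma sumset_sum:
  assumes "finite I" "\<And>i. i \<in> I \<Longrightarrow> a i \<in> D"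
  shows "sum a I \<in> sumset (card I) D"
  using assms by (induction I rule: finite_induct) auto

lemma smult_in_sumset:
  fixes x :: "'k::field ^ 'n"
  assumes "x \<in> D"
  shows "of_nat n *s x \<in> sumset n D"
proof -
  have "(\<Sum>i<n. x) = of_nat n *s x"
    by (induction n) (simp_all add: vec.scale_left_distrib add.commute del: sum_constant)
  then show ?thesis using sumset_sum[of "{..<n}" "\<lambda>_. x" D] assms by simp
qed

lemma of_nat_surj_prime_field:
  assumes "prime CARD('k::{field,finite})"
  obtains i where "i < CARD('k)" "of_nat i = (x :: 'k)"
proof -
  have "inj_on (of_nat :: nat \<Rightarrow> 'k) {..<CARD('k)}"
  proof (rule inj_onI)
    fix i j assume *: "i \<in> {..<CARD('k)}" "j \<in> {..<CARD('k)}" "of_nat i = (of_nat j :: 'k)"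
    have "i = j" if "i \<le> j" "j < CARD('k)" "of_nat i = (of_nat j :: 'k)" for i j
    proof -
      have "of_nat (j - i) = (0 :: 'k)" using that by (simp add: of_nat_diff)
      then have "CARD('k) dvd j - i" by (simp add: of_nat_eq_0_iff_char_dvd CHAR_eq_CARD[OF assms])
      then have "j - i = 0" using that by (metis dvd_imp_le less_imp_diff_less not_gr_zero not_le)
      then show ?thesis using that by simp
    qed
    then show "i = j" using * by (metis lessThan_iff nle_le)
  qed
  then have "of_nat ` {..<CARD('k)} = (UNIV :: 'k set)"
    by (intro card_subset_eq) (auto simp: card_image)
  then show ?thesis using that by (metis UNIV_I imageE lessThan_iff)
qed

section \<open>Iterates of linear maps, finite differences and nilpotency\<close>

lemma linear_funpow:
  assumes "Vector_Spaces.linear (*s) (*s) (\<phi> :: 'k::field ^ 'n \<Rightarrow> 'k ^ 'n)"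
  shows "Vector_Spaces.linear (*s) (*s) (\<phi> ^^ i)"
proof (induction i)
  case 0
  then show ?case using vec.linear_ident by (simp add: id_def)
next
  case (Suc i)
  then show ?case using Vector_Spaces.linear_compose[OF Suc assms] by (simp only: funpow.simps)
qed

text \<open>This is the binomial expansion of \<open>\<phi> ^ i\<close> for
  \<open>\<phi> = 1 + T\<close>; the induction step is Pascal's rule.\<close>

lemma funpow_newton:
  fixes \<phi> :: "'k::field ^ 'n \<Rightarrow> 'k ^ 'n"
  assumes "Vector_Spaces.linear (*s) (*s) \<phi>"
  shows "(\<phi> ^^ i) v = (\<Sum>j\<le>i. of_nat (i choose j) *s ((\<lambda>u. \<phi> u - u) ^^ j) v)"
proof -
  define T where "T = (\<lambda>u. \<phi> u - u)"
  have "(\<phi> ^^ i) v = (\<Sum>j\<le>i. of_nat (i choose j) *s (T ^^ j) v)"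
  proof (induction i arbitrary: v)
    case 0
    then show ?case by simp
  next
    case (Suc i)
    have "(\<phi> ^^ Suc i) v = (\<phi> ^^ i) (v + T v)" by (simp add: funpow_swap1 T_def)
    also have "\<dots> = (\<phi> ^^ i) v + (\<phi> ^^ i) (T v)"
      by (rule vec.linear_add[OF linear_funpow[OF assms]])
    \<comment> \<open>The first sum gains the index \<open>Suc i\<close> for free, since
      \<open>i choose Suc i\<close> is 0.\<close>
    also have "\<dots> = (\<Sum>j\<le>Suc i. of_nat (i choose j) *s (T ^^ j) v) + (\<Sum>j\<le>i. of_nat (i choose j) *s (T ^^ Suc j) v)"
      unfolding Suc.IH by (simp add: funpow_swap1 binomial_eq_0)
    also have "\<dots> = (\<Sum>j\<le>Suc i. of_nat (Suc i choose j) *s (T ^^ j) v)"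
      unfolding sum.atMost_Suc_shift by (simp add: sum.distrib vec.scale_left_distrib ac_simps)
    finally show ?case .
  qed
  then show ?thesis by (simp only: T_def)
qed

text \<open>All inner binomial coefficients of a prime vanish in the field, so the expansion reads
  \<open>v = v + T ^ p v\<close> with \<open>T = \<phi> - 1\<close>.\<close>

lemma nilpotent_of_prime_order:
  fixes \<phi> :: "'k::{field,finite} ^ 'n \<Rightarrow> 'k ^ 'n"
  assumes pr: "prime CARD('k)" and lin: "Vector_Spaces.linear (*s) (*s) \<phi>" and ord: "(\<phi> ^^ CARD('k)) v = v"
  shows "((\<lambda>u. \<phi> u - u) ^^ CARD('k)) v = 0"
proof -
  let ?p = "CARD('k)" and ?T = "\<lambda>u. \<phi> u - u"
  have p0: "?p > 0" by simp
  have "v = (\<Sum>j\<le>?p. of_nat (?p choose j) *s (?T ^^ j) v)"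
    using funpow_newton[OF lin, of ?p v] ord by simp
  also have "\<dots> = (\<Sum>j\<in>{0, ?p}. of_nat (?p choose j) *s (?T ^^ j) v)"
  proof (rule sum.mono_neutral_right)
    show "\<forall>j\<in>{..?p} - {0, ?p}. of_nat (?p choose j) *s (?T ^^ j) v = 0"
    proof
      fix j assume "j \<in> {..?p} - {0, ?p}"
      then have "0 < j" "j < ?p" by auto
      then have "?p dvd (?p choose j)" using pr by (intro dvd_choose_prime) auto
      then have "of_nat (?p choose j) = (0 :: 'k)"
        by (simp add: of_nat_eq_0_iff_char_dvd CHAR_eq_CARD[OF pr])
      then show "of_nat (?p choose j) *s (?T ^^ j) v = 0" by simp
    qed
  qed auto
  also have "\<dots> = v + (?T ^^ ?p) v" by simp
  finally show ?thesis by simp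
qed

text \<open>The spans \<open>A j\<close> of the tails of the sequence of iterates decrease strictly
  until they reach zero. More than \<open>CARD('n)\<close> nonzero iterates would make
  \<open>A 0\<close> too large.\<close>

lemma nilpotent_dim:
  fixes \<psi> :: "'k::field ^ 'n \<Rightarrow> 'k ^ 'n"
  assumes lin: "Vector_Spaces.linear (*s) (*s) \<psi>" and nil: "(\<psi> ^^ m) v = 0"
  shows "(\<psi> ^^ CARD('n)) v = 0"
proof (rule ccontr)
  assume nz: "(\<psi> ^^ CARD('n)) v \<noteq> 0"
  define A where "A j = vec.span ((\<lambda>i. (\<psi> ^^ i) v) ` {j..})" for j
  define r where "r = (LEAST i. (\<psi> ^^ i) v = 0)"
  have r0: "(\<psi> ^^ r) v = 0" unfolding r_def using nil by (rule LeastI)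
  have zero: "(\<psi> ^^ i) v = 0" if "i \<ge> r" for i
  proof -
    have "(\<psi> ^^ i) v = (\<psi> ^^ (i - r)) ((\<psi> ^^ r) v)"
      using that by (metis add.commute comp_apply funpow_add le_add_diff_inverse)
    then show ?thesis using r0 vec.linear_0[OF linear_funpow[OF lin]] by simp
  qed
  then have r: "CARD('n) < r" using nz not_le by blast
  have image: "\<psi> x \<in> A (Suc j)" if "x \<in> A j" for x j
  proof -
    have "\<psi> x \<in> vec.span (\<psi> ` (\<lambda>i. (\<psi> ^^ i) v) ` {j..})"
      using that vec.linear_span_image[OF lin] unfolding A_def by blast
    also have "\<psi> ` (\<lambda>i. (\<psi> ^^ i) v) ` {j..} \<subseteq> (\<lambda>i. (\<psi> ^^ i) v) ` {Suc j..}"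
    proof (clarsimp)
      fix i assume "j \<le> i"
      then show "\<psi> ((\<psi> ^^ i) v) \<in> (\<lambda>i. (\<psi> ^^ i) v) ` {Suc j..}"
        by (intro image_eqI[of _ _ "Suc i"]) auto
    qed
    then have "vec.span (\<psi> ` (\<lambda>i. (\<psi> ^^ i) v) ` {j..}) \<subseteq> A (Suc j)"
      unfolding A_def by (rule vec.span_mono)
    finally show ?thesis .
  qed
  \<comment> \<open>If an iterate lay in the span of the later ones, so would all its successors, in
    particular the last nonzero iterate, after which only zeros follow.\<close>
  have notin: "(\<psi> ^^ j) v \<notin> A (Suc j)" if jn: "j \<le> CARD('n)" for j
  proof
    assume j: "(\<psi> ^^ j) v \<in> A (Suc j)"
    have later: "(\<psi> ^^ i) v \<in> A (Suc i)" if "j \<le> i" for i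
      using that
    proof (induction i rule: dec_induct)
      case base
      then show ?case by (rule j)
    next
      case (step i)
      from image[OF step.IH] show ?case by simp
    qed
    obtain i where i: "r = Suc i" "j \<le> i" using r jn by (cases r) auto
    have "(\<lambda>i. (\<psi> ^^ i) v) ` {Suc i..} \<subseteq> {0}" using zero i by auto
    then have "A (Suc i) \<subseteq> vec.span {0}" unfolding A_def by (rule vec.span_mono)
    then have "(\<psi> ^^ i) v = 0" using later[OF i(2)] by auto
    then show False using i(1) not_less_Least[of i "\<lambda>i. (\<psi> ^^ i) v = 0"] unfolding r_def by auto
  qed
  have "vec.dim (A j) \<ge> CARD('n) + 1 - j" if "j \<le> CARD('n) + 1" for j
    using that
  proof (induction j rule: inc_induct)
    case base
    then show ?case by simp
  next
    case (step j)
    have "{j..} = insert j {Suc j..}" by auto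
    then have "A j = vec.span (insert ((\<psi> ^^ j) v) ((\<lambda>i. (\<psi> ^^ i) v) ` {Suc j..}))"
      by (simp add: A_def)
    then have "vec.dim (A j) = vec.dim (A (Suc j)) + 1"
      using notin[of j] step.hyps by (simp add: A_def vec.dim_insert)
    then show ?case using step.IH step.hyps by simp
  qed
  from this[of 0] have "vec.dim (A 0) > CARD('n)" by simp
  then show False using dim_subset_UNIV_cart_gen[of "A 0"] by simp
qed

text \<open>The condition \<open>k < i \<longrightarrow> a i k = 0\<close> makes the coordinate polynomials of the curve
  \<open>\<Sum>j. x ^ j *s w j\<close> modulo \<open>U\<close> in the basis \<open>w k\<close>, \<open>k \<in> K\<close>, have the pairwise distinct degrees \<open>k\<close>.\<close>

definition echelon_basis ::
  "('k::field ^ 'n) set \<Rightarrow> (nat \<Rightarrow> 'k ^ 'n) \<Rightarrow> nat set \<Rightarrow> nat set \<Rightarrow> (nat \<Rightarrow> nat \<Rightarrow> 'k) \<Rightarrow> bool" where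
  "echelon_basis U w J K a \<longleftrightarrow> K \<subseteq> J \<and> vec.dim (U \<union> w ` J) = vec.dim U + card K
    \<and> (\<forall>i\<in>J. w i - (\<Sum>k\<in>K. a i k *s w k) \<in> U) \<and> (\<forall>i\<in>J. \<forall>k\<in>K. k < i \<longrightarrow> a i k = 0)
    \<and> (\<forall>k\<in>K. a k k = 1) \<and> (\<forall>y\<in>vec.span (U \<union> w ` J). \<exists>c. y - (\<Sum>k\<in>K. c k *s w k) \<in> U)"

text \<open>The induction adds vectors at the front. Either \<open>w s\<close> is expressed through
  \<open>U\<close> and basis vectors of larger index, or it becomes a basis vector itself; in both
  cases no coefficient occurs at an index below its own.\<close>

lemma ex_echelon_basis:
  fixes U :: "('k::field ^ 'n) set" and w :: "nat \<Rightarrow> 'k ^ 'n"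
  assumes "vec.subspace U"
  shows "\<exists>K a. echelon_basis U w {s..<s + n} K a"
proof (induction n arbitrary: s)
  case 0
  have "y \<in> U" if "y \<in> vec.span U" for y using that assms vec.span_eq_iff by blast
  then show ?case by (intro exI[of _ "{}"]) (simp add: echelon_basis_def)
next
  case (Suc n)
  let ?X = "U \<union> w ` {Suc s..<Suc s + n}"
  obtain K a where E: "echelon_basis U w {Suc s..<Suc s + n} K a"
    using Suc.IH[of "Suc s"] by blast
  have K: "K \<subseteq> {Suc s..<Suc s + n}" "vec.dim ?X = vec.dim U + card K"
    and a: "\<And>i. i \<in> {Suc s..<Suc s + n} \<Longrightarrow> w i - (\<Sum>k\<in>K. a i k *s w k) \<in> U"
      "\<And>i k. i \<in> {Suc s..<Suc s + n} \<Longrightarrow> k \<in> K \<Longrightarrow> k < i \<Longrightarrow> a i k = 0"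
      "\<And>k. k \<in> K \<Longrightarrow> a k k = 1"
    and c: "\<And>y. y \<in> vec.span ?X \<Longrightarrow> \<exists>c. y - (\<Sum>k\<in>K. c k *s w k) \<in> U"
    using E unfolding echelon_basis_def by blast+
  have finK: "finite K" and sK: "s \<notin> K" using K(1) finite_subset[OF K(1)] by auto
  have ivl: "{s..<s + Suc n} = insert s {Suc s..<Suc s + n}" by auto
  have X: "U \<union> w ` {s..<s + Suc n} = insert (w s) ?X" unfolding ivl by auto
  have 0: "0 \<in> U" using assms by (rule vec.subspace_0)
  show ?case
  proof (cases "w s \<in> vec.span ?X")
    case True
    then obtain c0 where c0: "w s - (\<Sum>k\<in>K. c0 k *s w k) \<in> U" using c by blast
    have "vec.span (insert (w s) ?X) = vec.span ?X" using True by (rule vec.span_redundant)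
    moreover have "vec.dim (insert (w s) ?X) = vec.dim ?X" using True by (simp add: vec.dim_insert)
    moreover have "(a(s := c0)) i = a i" if "i \<in> {Suc s..<Suc s + n}" for i using that by auto
    ultimately have "echelon_basis U w {s..<s + Suc n} K (a(s := c0))"
      unfolding echelon_basis_def X unfolding ivl using K c a c0 sK by auto
    then show ?thesis by blast
  next
    case False
    define a' where "a' i k = (if i = s then if k = s then 1 else 0 else if k = s then 0 else a i k)" for i k
    have sumI: "(\<Sum>k\<in>insert s K. g k *s w k) = g s *s w s + (\<Sum>k\<in>K. g k *s w k)" for g
      using finK sK by simp
    have 1: "w i - (\<Sum>k\<in>insert s K. a' i k *s w k) \<in> U" if "i \<in> insert s {Suc s..<Suc s + n}" for i
    proof (cases "i = s")
      case True
      have "(\<Sum>k\<in>K. a' s k *s w k) = 0" using sK by (intro sum.neutral) (auto simp: a'_def)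
      then show ?thesis using True 0 unfolding sumI by (simp add: a'_def)
    next
      case False
      have "(\<Sum>k\<in>K. a' i k *s w k) = (\<Sum>k\<in>K. a i k *s w k)"
        using sK False by (intro sum.cong) (auto simp: a'_def)
      then show ?thesis using False a(1)[of i] that unfolding sumI by (simp add: a'_def)
    qed
    have 2: "\<exists>c. y - (\<Sum>k\<in>insert s K. c k *s w k) \<in> U" if y: "y \<in> vec.span (insert (w s) ?X)" for y
    proof -
      obtain t where "y - t *s w s \<in> vec.span ?X" using y by (auto simp: vec.span_insert)
      then obtain c0 where c0: "y - t *s w s - (\<Sum>k\<in>K. c0 k *s w k) \<in> U" using c by blast
      have "(\<Sum>k\<in>K. (c0(s := t)) k *s w k) = (\<Sum>k\<in>K. c0 k *s w k)"
        using sK by (intro sum.cong) auto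
      then have "y - (\<Sum>k\<in>insert s K. (c0(s := t)) k *s w k) \<in> U"
        using c0 unfolding sumI by (simp add: diff_diff_eq)
      then show ?thesis by blast
    qed
    have "echelon_basis U w {s..<s + Suc n} (insert s K) a'" unfolding echelon_basis_def X
    proof (intro conjI)
      show "insert s K \<subseteq> {s..<s + Suc n}" using K(1) by auto
      show "vec.dim (insert (w s) ?X) = vec.dim U + card (insert s K)"
        using False K(2) finK sK by (simp add: vec.dim_insert)
      show "\<forall>i\<in>{s..<s + Suc n}. w i - (\<Sum>k\<in>insert s K. a' i k *s w k) \<in> U"
        unfolding ivl using 1 by blast
      show "\<forall>i\<in>{s..<s + Suc n}. \<forall>k\<in>insert s K. k < i \<longrightarrow> a' i k = 0"
        unfolding ivl using a(2) K(1) by (auto simp: a'_def)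
      show "\<forall>k\<in>insert s K. a' k k = 1" using a(3) by (auto simp: a'_def)
    qed (use 2 in blast)
    then show ?thesis by blast
  qed
qed

text \<open>Modulo \<open>U\<close> the curve minus its constant term \<open>w 0\<close> has monic
  coordinates \<open>f k\<close> of distinct degrees in an echelon basis. Solving the power sum
  system makes \<open>n\<close> curve points add up to any prescribed coordinates; the shift
  \<open>b\<close> consists of the \<open>n\<close> constant terms.\<close>

lemma curve_sums_cover:
  fixes U D :: "('k::{field,finite} ^ 'n) set" and w :: "nat \<Rightarrow> 'k ^ 'n" and M :: "nat \<Rightarrow> 'k poly"
  assumes pr: "prime CARD('k)" and U: "vec.subspace U" and r: "r * r \<le> CARD('k)"
    and M: "\<And>j. j < r \<Longrightarrow> degree (M j) = j \<and> lead_coeff (M j) = 1"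
    and D: "\<And>x. (\<Sum>j<r. poly (M j) x *s w j) \<in> D"
  shows "\<exists>n b. n \<le> r * r * (vec.dim (U \<union> w ` {1..<r}) - vec.dim U)
    \<and> (\<forall>y\<in>vec.span (U \<union> w ` {1..<r}). \<exists>u\<in>U. b + y + u \<in> sumset n D)"
proof (cases "r = 0")
  case True
  have "y \<in> U" if "y \<in> vec.span U" for y using that U vec.span_eq_iff by blast
  moreover have "\<exists>u\<in>U. 0 + y + u = 0" if "y \<in> U" for y
    using vec.subspace_neg[OF U that] by (intro bexI[of _ "- y"]) auto
  ultimately show ?thesis using True by (intro exI[of _ 0]) auto
next
  case False
  have ivl: "{1..<1 + (r - 1)} = {1..<r}" using False by auto
  obtain K a where E: "echelon_basis U w {1..<r} K a"
    using ex_echelon_basis[OF U, of w 1 "r - 1"] unfolding ivl by blast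
  have K: "K \<subseteq> {1..<r}" "vec.dim (U \<union> w ` {1..<r}) = vec.dim U + card K"
    and a: "\<And>i. i \<in> {1..<r} \<Longrightarrow> w i - (\<Sum>k\<in>K. a i k *s w k) \<in> U"
      "\<And>i k. i \<in> {1..<r} \<Longrightarrow> k \<in> K \<Longrightarrow> k < i \<Longrightarrow> a i k = 0"
      "\<And>k. k \<in> K \<Longrightarrow> a k k = 1"
    and c: "\<And>y. y \<in> vec.span (U \<union> w ` {1..<r}) \<Longrightarrow> \<exists>c. y - (\<Sum>k\<in>K. c k *s w k) \<in> U"
    using E unfolding echelon_basis_def by blast+
  have finK: "finite K" using K(1) by (rule finite_subset) simp
  \<comment> \<open>In \<open>f k\<close> the terms with \<open>i > k\<close> vanish by the echelon
    condition and those with \<open>i < k\<close> have smaller degree, so \<open>M k\<close> with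
    coefficient 1 determines degree and leading coefficient.\<close>
  define f where "f k = (\<Sum>i\<in>{1..<r}. smult (a i k) (M i))" for k
  have f: "degree (f k) = k \<and> lead_coeff (f k) = 1" if k: "k \<in> K" for k
  proof -
    have kr: "k \<in> {1..<r}" using k K by auto
    have le: "degree (smult (a i k) (M i)) \<le> k" if "i \<in> {1..<r}" for i
    proof (cases "k < i")
      case True
      then show ?thesis using a(2)[OF that k] by simp
    next
      case False
      have "degree (smult (a i k) (M i)) \<le> degree (M i)" by (rule degree_smult_le)
      then show ?thesis using M[of i] that False by simp
    qed
    have deg: "degree (f k) \<le> k" unfolding f_def using le by (intro degree_sum_le) auto
    have "coeff (f k) k = (\<Sum>i\<in>{1..<r}. a i k * coeff (M i) k)" by (simp add: f_def coeff_sum)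
    also have "\<dots> = (\<Sum>i\<in>{1..<r}. if i = k then 1 else 0)"
    proof (rule sum.cong[OF refl])
      fix i assume i: "i \<in> {1..<r}"
      consider "i < k" | "i = k" | "k < i" by linarith
      then show "a i k * coeff (M i) k = (if i = k then 1 else 0)"
      proof cases
        case 1
        then have "coeff (M i) k = 0" using M[of i] i by (intro coeff_eq_0) auto
        then show ?thesis using 1 by simp
      next
        case 2
        then show ?thesis using M[of k] i a(3)[OF k] by auto
      next
        case 3
        then show ?thesis using a(2)[OF i k] by simp
      qed
    qed
    also have "\<dots> = 1" using kr by simp
    finally have "coeff (f k) k = 1" .
    then show ?thesis using deg by (metis le_antisym le_degree zero_neq_one)
  qed
  have mod: "(\<Sum>j<r. poly (M j) x *s w j) - w 0 - (\<Sum>k\<in>K. poly (f k) x *s w k) \<in> U" for x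
  proof -
    have M0: "poly (M 0) x = 1" using M[of 0] False by (auto elim!: degree_eq_zeroE)
    have "{..<r} = insert 0 {1..<r}" using False by auto
    then have "(\<Sum>j<r. poly (M j) x *s w j) = w 0 + (\<Sum>j\<in>{1..<r}. poly (M j) x *s w j)"
      using M0 by simp
    moreover have "(\<Sum>k\<in>K. poly (f k) x *s w k) = (\<Sum>j\<in>{1..<r}. poly (M j) x *s (\<Sum>k\<in>K. a j k *s w k))"
      unfolding f_def poly_sum vec.scale_sum_left vec.scale_sum_right
      by (subst sum.swap) (simp add: mult.commute)
    ultimately have "(\<Sum>j<r. poly (M j) x *s w j) - w 0 - (\<Sum>k\<in>K. poly (f k) x *s w k)
      = (\<Sum>j\<in>{1..<r}. poly (M j) x *s (w j - (\<Sum>k\<in>K. a j k *s w k)))"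
      by (simp add: vec.scale_right_diff_distrib sum_subtractf)
    also have "\<dots> \<in> U" using a(1) U by (intro vec.subspace_sum vec.subspace_scale) auto
    finally show ?thesis .
  qed
  define n where "n = (\<Sum>l\<in>K. l * (l + 1))"
  \<comment> \<open>Each \<open>l \<in> K\<close> satisfies \<open>l + 1 \<le> r\<close>, so one new
    dimension costs at most \<open>r * r\<close> points.\<close>
  have "n \<le> (\<Sum>l\<in>K. r * r)" unfolding n_def using K(1) by (intro sum_mono mult_mono) auto
  then have n: "n \<le> r * r * (vec.dim (U \<union> w ` {1..<r}) - vec.dim U)" using K(2) by (simp add: mult.commute)
  have "\<exists>u\<in>U. of_nat n *s w 0 + y + u \<in> sumset n D" if y: "y \<in> vec.span (U \<union> w ` {1..<r})" for y
  proof -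
    obtain c0 where c0: "y - (\<Sum>k\<in>K. c0 k *s w k) \<in> U" using c[OF y] by blast
    have Klt: "0 < l \<and> l * l < CARD('k)" if "l \<in> K" for l
    proof -
      have "l < r" "0 < l" using that K(1) by auto
      then have "l * l < r * r" by (intro mult_strict_mono) auto
      then show ?thesis using r \<open>0 < l\<close> by linarith
    qed
    obtain x :: "nat \<Rightarrow> 'k" where x: "\<And>l. l \<in> K \<Longrightarrow> (\<Sum>i<n. poly (f l) (x i)) = c0 l"
      using power_sum_system_solvable[OF pr finK Klt f, of c0] unfolding n_def by auto
    define z where "z i = (\<Sum>j<r. poly (M j) (x i) *s w j)" for i
    have "(\<Sum>i<n. z i) \<in> sumset n D" using sumset_sum[of "{..<n}" z D] D by (simp add: z_def)
    moreover have "(\<Sum>i<n. z i - w 0 - (\<Sum>k\<in>K. poly (f k) (x i) *s w k)) \<in> U"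
      using mod U by (intro vec.subspace_sum) (auto simp: z_def)
    moreover have "(\<Sum>i<n. \<Sum>k\<in>K. poly (f k) (x i) *s w k) = (\<Sum>k\<in>K. c0 k *s w k)"
      by (subst sum.swap) (simp add: x flip: vec.scale_sum_left)
    moreover have "(\<Sum>i<n. w 0) = of_nat n *s w 0"
      by (induction n) (simp_all add: vec.scale_left_distrib add.commute del: sum_constant)
    ultimately have zU: "(\<Sum>i<n. z i) - of_nat n *s w 0 - (\<Sum>k\<in>K. c0 k *s w k) \<in> U"
      and zD: "(\<Sum>i<n. z i) \<in> sumset n D" by (simp_all add: sum_subtractf)
    have "(\<Sum>i<n. z i) - of_nat n *s w 0 - y \<in> U"
      using vec.subspace_diff[OF U zU c0] by (simp add: algebra_simps)
    then show ?thesis using zD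
      by (intro bexI[of _ "(\<Sum>i<n. z i) - of_nat n *s w 0 - y"]) (simp_all add: algebra_simps)
  qed
  then show ?thesis using n by blast
qed

section \<open>Orbits of irreducible groups\<close>

lemma linear_vector_matrix_mult: "Vector_Spaces.linear (*s) (*s) (\<lambda>u :: 'k::field ^ 'n. u v* A)"
proof -
  have "(*v) (transpose A) = (\<lambda>u. u v* A)" by (simp add: fun_eq_iff)
  then show ?thesis using matrix_vector_mul_linear_gen[of "transpose A"] by simp
qed

text \<open>Falling factorials: \<open>fact j\<close> times the binomial coefficient as a polynomial
  in its upper argument. Without the denominator they are monic over any field.\<close>

lemma falling_factorial_poly:
  defines "M \<equiv> \<lambda>j. \<Prod>m<j. [:- of_nat m, 1:]"
  shows "degree (M j :: 'k::field poly) = j" "lead_coeff (M j :: 'k poly) = 1"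
    and "poly (M j) (of_nat i :: 'k) = of_nat (fact j * (i choose j))"
proof -
  show "degree (M j :: 'k poly) = j" unfolding M_def by (subst degree_prod_eq_sum_degree) auto
  show "lead_coeff (M j :: 'k poly) = 1" unfolding M_def by (subst lead_coeff_prod) auto
  show "poly (M j) (of_nat i :: 'k) = of_nat (fact j * (i choose j))"
  proof (induction j)
    case 0
    then show ?case by (simp add: M_def)
  next
    case (Suc j)
    have "poly (M (Suc j)) (of_nat i :: 'k) = of_nat (fact j * (i choose j)) * (of_nat i - of_nat j)"
      using Suc by (simp add: M_def algebra_simps)
    also have "\<dots> = of_nat (fact j * ((i - j) * (i choose j)))"
      by (cases "j \<le> i") (simp_all add: of_nat_diff algebra_simps binomial_eq_0)
    also have "(i - j) * (i choose j) = Suc j * (i choose Suc j)"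
      using binomial_absorption[of j i] binomial_absorb_comp[of i j] by simp
    finally show ?case by (simp add: algebra_simps)
  qed
qed

text \<open>Cauchy's theorem, obtained from \<open>sylow_thm\<close> with exponent 1: a subgroup of
  prime order contains a nonidentity element whose \<open>p\<close>-th power is the identity. Powers
  in the group are then read as iterates on row vectors.\<close>

lemma ex_order_prime:
  fixes G :: "('k::{field,finite} ^ 'n ^ 'n) set"
  assumes pr: "prime CARD('k)" and G: "is_linear_group G" and dvd: "CARD('k) dvd card G"
  shows "\<exists>g\<in>G. g \<noteq> mat 1 \<and> (\<forall>u. ((\<lambda>u. u v* g) ^^ CARD('k)) u = u)"
proof -
  define H where "H = \<lparr>carrier = G, monoid.mult = (**), monoid.one = mat 1 :: 'k ^ 'n ^ 'n\<rparr>"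
  have G1: "mat 1 \<in> G" and Ginv: "\<And>A. A \<in> G \<Longrightarrow> invertible A \<and> matrix_inv A \<in> G"
    and Gmul: "\<And>A B. A \<in> G \<Longrightarrow> B \<in> G \<Longrightarrow> A ** B \<in> G"
    using G by (auto simp: is_linear_group_def)
  have inv: "matrix_inv A ** A = mat 1" if "A \<in> G" for A
    using Ginv[OF that] someI_ex[of "\<lambda>A'. A ** A' = mat 1 \<and> A' ** A = mat 1"]
    unfolding invertible_def matrix_inv_def by blast
  interpret H: group H
  proof (rule groupI)
    show "\<exists>y\<in>carrier H. y \<otimes>\<^bsub>H\<^esub> x = \<one>\<^bsub>H\<^esub>" if "x \<in> carrier H" for x
      using that inv Ginv by (auto simp: H_def)
  qed (auto simp: H_def G1 Gmul matrix_mul_assoc)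
  obtain m where "card G = CARD('k) * m" using dvd ..
  then have "Coset.order H = CARD('k) ^ 1 * m" by (simp add: Coset.order_def H_def)
  then obtain P where P: "subgroup P H" "card P = CARD('k)"
    using sylow_thm[OF pr H.group_axioms, of 1 m] by auto
  have "card P > 1" using P(2) prime_gt_1_nat[OF pr] by simp
  then obtain g where g: "g \<in> P" "g \<noteq> mat 1"
    by (metis One_nat_def card_le_Suc0_iff_eq card_gt_0_iff less_one not_le order_less_trans zero_less_one)
  have gG: "g \<in> G" using g P subgroup.subset by (fastforce simp: H_def)
  interpret HP: group "H\<lparr>carrier := P\<rparr>" using subgroup.subgroup_is_group[OF P(1) H.group_axioms] .
  have "g [^]\<^bsub>H\<lparr>carrier := P\<rparr>\<^esub> Coset.order (H\<lparr>carrier := P\<rparr>) = \<one>\<^bsub>H\<lparr>carrier := P\<rparr>\<^esub>"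
    using g by (intro HP.pow_order_eq_1) simp
  then have "g [^]\<^bsub>H\<^esub> CARD('k) = mat 1"
    using P(2) by (simp add: Coset.order_def H_def H.nat_pow_consistent[of g _ P, unfolded H_def])
  moreover have "((\<lambda>u. u v* g) ^^ n) u = u v* (g [^]\<^bsub>H\<^esub> n)" for n u
    by (induction n) (simp_all add: H_def vector_matrix_mul_assoc)
  ultimately show ?thesis using gG g by auto
qed

text \<open>Otherwise the vectors \<open>(x v* g - x) v* A\<close> span an invariant subspace inside
  the proper subspace \<open>U\<close>, which is zero by irreducibility. Then \<open>g\<close> fixes
  the orbit pointwise; the orbit spans the whole space, again by irreducibility, so \<open>g\<close>
  is the identity.\<close>

lemma ex_moved_orbit_vector:
  fixes G :: "('k::{field,finite} ^ 'n ^ 'n) set"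
  assumes G: "is_linear_group G" and irr: "irreducible_lin G" and g: "g \<noteq> mat 1"
    and v: "v \<noteq> 0" and U: "vec.subspace U" "U \<noteq> UNIV"
  shows "\<exists>x\<in>orbit_lin G v. \<exists>A\<in>G. (x v* g - x) v* A \<notin> U"
proof (rule ccontr)
  assume neg: "\<not> ?thesis"
  have G1: "mat 1 \<in> G" and Gmul: "\<And>A B. A \<in> G \<Longrightarrow> B \<in> G \<Longrightarrow> A ** B \<in> G"
    using G by (auto simp: is_linear_group_def)
  have inv_span: "w v* B \<in> vec.span Y" if "\<And>x. x \<in> Y \<Longrightarrow> x v* B \<in> Y" "w \<in> vec.span Y" for B w and Y :: "('k ^ 'n) set"
  proof -
    have "w v* B \<in> vec.span ((\<lambda>u. u v* B) ` Y)"
      using that(2) vec.linear_span_image[OF linear_vector_matrix_mult] by blast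
    also have "\<dots> \<subseteq> vec.span Y" using that(1) by (intro vec.span_mono) auto
    finally show ?thesis .
  qed
  have full: "vec.span Y = {0} \<or> vec.span Y = UNIV"
    if "\<And>x B. x \<in> Y \<Longrightarrow> B \<in> G \<Longrightarrow> x v* B \<in> Y" for Y :: "('k ^ 'n) set"
    using irr inv_span[of Y] that vec.subspace_span[of Y] unfolding irreducible_lin_def by blast
  define Y where "Y = {(x v* g - x) v* A | x A. x \<in> orbit_lin G v \<and> A \<in> G}"
  have "y v* B \<in> Y" if y: "y \<in> Y" and B: "B \<in> G" for y B
  proof -
    obtain x A where xA: "y = (x v* g - x) v* A" "x \<in> orbit_lin G v" "A \<in> G" using y by (auto simp: Y_def)
    then have "y v* B = (x v* g - x) v* (A ** B)" by (simp add: vector_matrix_mul_assoc)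
    then show ?thesis using xA Gmul[OF _ B] unfolding Y_def by blast
  qed
  then have "vec.span Y = {0} \<or> vec.span Y = UNIV" by (rule full)
  moreover have "vec.span Y \<subseteq> U" using neg U(1) by (intro vec.span_minimal) (auto simp: Y_def)
  ultimately have "vec.span Y = {0}" using U(2) by auto
  then have "Y \<subseteq> {0}" using vec.span_superset by blast
  then have fixed: "x v* g = x" if "x \<in> orbit_lin G v" for x
    using that G1 unfolding Y_def by fastforce
  have "vec.span (orbit_lin G v) = {0} \<or> vec.span (orbit_lin G v) = UNIV"
  proof (rule full)
    fix x B assume "x \<in> orbit_lin G v" "B \<in> G"
    then show "x v* B \<in> orbit_lin G v" using Gmul by (auto simp: orbit_lin_def vector_matrix_mul_assoc)
  qed
  moreover have "v \<in> orbit_lin G v" using G1 by (force simp: orbit_lin_def)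
  then have "v \<in> vec.span (orbit_lin G v)" by (rule vec.span_base)
  ultimately have sp: "vec.span (orbit_lin G v) = UNIV" using v by auto
  have "vec.subspace {x. x v* g = x}"
    by (auto simp: vec.subspace_def vector_matrix_left_distrib scalar_vector_matrix_assoc)
  then have "vec.span (orbit_lin G v) \<subseteq> {x. x v* g = x}"
    using fixed by (intro vec.span_minimal) auto
  then have "x v* g = x v* mat 1" for x using sp by auto
  then have "transpose g *v x = transpose (mat 1) *v x" for x by simp
  then have "transpose g = transpose (mat 1)" by (simp add: matrix_eq)
  then show False using g by (metis transpose_transpose)
qed

text \<open>The points of \<open>U'\<close> are reached only up to a correction
  \<open>u \<in> U\<close>, which the coset of \<open>U\<close> covered earlier can absorb.\<close>

lemma orbit_covers_larger_subspace:
  fixes G :: "('k::{field,finite} ^ 'n ^ 'n) set"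
  assumes pr: "prime CARD('k)" and G: "is_linear_group G" and irr: "irreducible_lin G"
    and dvd: "CARD('k) dvd card G" and v: "v \<noteq> 0" and U: "vec.subspace U" "U \<noteq> UNIV"
  shows "\<exists>U' n b. vec.subspace U' \<and> vec.dim U < vec.dim U' \<and> n \<le> 9 * CARD('n) ^ 2 * (vec.dim U' - vec.dim U)
    \<and> (\<forall>y\<in>U'. \<exists>u\<in>U. b + y + u \<in> sumset n (orbit_lin G v \<union> {0}))"
proof -
  let ?p = "CARD('k)" and ?d = "CARD('n)" and ?D = "orbit_lin G v \<union> {0}"
  obtain g where g: "g \<in> G" "g \<noteq> mat 1" "\<And>u. ((\<lambda>u. u v* g) ^^ ?p) u = u"
    using ex_order_prime[OF pr G dvd] by blast
  obtain x A where x: "x \<in> orbit_lin G v" "A \<in> G" "(x v* g - x) v* A \<notin> U"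
    using ex_moved_orbit_vector[OF G irr g(2) v U] by blast
  define \<phi> where "\<phi> = (\<lambda>u. u v* g)"
  define T where "T = (\<lambda>u. \<phi> u - u)"
  have lin\<phi>: "Vector_Spaces.linear (*s) (*s) \<phi>" unfolding \<phi>_def by (rule linear_vector_matrix_mult)
  have linT: "Vector_Spaces.linear (*s) (*s) T"
    unfolding T_def using lin\<phi> vec.linear_ident by (rule vec.linear_compose_sub)
  have Gmul: "\<And>A B. A \<in> G \<Longrightarrow> B \<in> G \<Longrightarrow> A ** B \<in> G"
    using G by (auto simp: is_linear_group_def)
  have inO: "y v* B \<in> orbit_lin G v" if "y \<in> orbit_lin G v" "B \<in> G" for y B
    using that Gmul by (auto simp: orbit_lin_def vector_matrix_mul_assoc)
  have powO: "(\<phi> ^^ i) x \<in> orbit_lin G v" for i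
    by (induction i) (simp_all add: x(1) \<phi>_def inO g(1))
  show ?thesis
  \<comment> \<open>The threshold is the number of summands allowed for one new dimension.\<close>
  proof (cases "?p \<le> 9 * ?d ^ 2")
    case True
    define a where "a = x v* A"
    define e where "e = (x v* g - x) v* A"
    have aD: "a \<in> ?D" "a + e \<in> ?D"
      using inO[OF x(1,2)] inO[OF inO[OF x(1) g(1)] x(2)]
      by (simp_all add: a_def e_def vector_matrix_mult_diff_distrib)
    have spU: "vec.span U = U" using U(1) by (simp only: vec.span_eq_iff)
    have dim: "vec.dim (insert e U) = vec.dim U + 1"
      using x(3) by (simp add: vec.dim_insert spU e_def)
    have "\<exists>u\<in>U. of_nat (?p - 1) *s a + y + u \<in> sumset (?p - 1) ?D" if y: "y \<in> vec.span (insert e U)" for y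
    proof -
      obtain t where t: "y - t *s e \<in> U" using y spU by (auto simp: vec.span_insert)
      obtain i where i: "i < ?p" "of_nat i = t" using of_nat_surj_prime_field[OF pr] .
      \<comment> \<open>Taking \<open>a + e\<close> with multiplicity \<open>i\<close> and
        \<open>a\<close> for the rest of \<open>p - 1\<close> summands gives
        \<open>(p - 1) a + i e\<close>; as \<open>i\<close> varies this runs through a whole
        line.\<close>
      have "of_nat (?p - 1 - i) *s a + of_nat i *s (a + e) \<in> sumset (?p - 1 - i + i) ?D"
        by (intro sumset_add smult_in_sumset aD)
      moreover have "of_nat (?p - 1 - i) *s a + of_nat i *s (a + e) = of_nat (?p - 1 - i + i) *s a + t *s e"
        unfolding of_nat_add vec.scale_left_distrib vec.scale_right_distrib i(2) by simp
      moreover have "?p - 1 - i + i = ?p - 1" using i(1) by simp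
      ultimately have "of_nat (?p - 1) *s a + t *s e \<in> sumset (?p - 1) ?D" by metis
      moreover have "- (y - t *s e) \<in> U" using t by (rule vec.subspace_neg[OF U(1)])
      ultimately show ?thesis
        by (intro bexI[of _ "- (y - t *s e)"]) (simp_all add: algebra_simps)
    qed
    moreover have "?p - 1 \<le> 9 * ?d ^ 2 * (vec.dim (vec.span (insert e U)) - vec.dim U)"
      using True dim by simp
    moreover have "vec.dim U < vec.dim (vec.span (insert e U))" using dim by simp
    ultimately show ?thesis using vec.subspace_span by blast
  next
    case False
    have dp: "?d * ?d \<le> ?p" using False by (simp add: power2_eq_square)
    have "?d \<le> ?d * ?d" by simp
    have dltp: "?d < ?p" using False \<open>?d \<le> ?d * ?d\<close> unfolding power2_eq_square by linarith
    have nilp: "(T ^^ ?p) x = 0"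
      unfolding T_def using nilpotent_of_prime_order[OF pr lin\<phi>] g(3) by (simp add: \<phi>_def)
    have T0: "(T ^^ j) x = 0" if "?d \<le> j" for j
    proof -
      have "(T ^^ j) x = (T ^^ (j - ?d)) ((T ^^ ?d) x)"
        using that by (metis add.commute comp_apply funpow_add le_add_diff_inverse)
      then show ?thesis using nilpotent_dim[OF linT nilp] vec.linear_0[OF linear_funpow[OF linT]] by simp
    qed
    \<comment> \<open>Dividing by \<open>fact j\<close>, which is invertible for
      \<open>j < d < p\<close>, compensates the factor of the monic polynomial \<open>M j\<close>:
      at \<open>i\<close> the product is the term of index \<open>j\<close> in the Newton expansion
      of \<open>\<phi> ^ i\<close>.\<close>
    define w where "w j = inverse (of_nat (fact j)) *s ((T ^^ j) x v* A)" for j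
    define M :: "nat \<Rightarrow> 'k poly" where "M j = (\<Prod>m<j. [:- of_nat m, 1:])" for j
    have M: "degree (M j) = j \<and> lead_coeff (M j) = 1" for j
      unfolding M_def using falling_factorial_poly(1,2) by blast
    have fact0: "of_nat (fact j) \<noteq> (0 :: 'k)" if "j < ?d" for j
      using that dltp prime_dvd_fact_iff[OF pr, of j]
      by (simp add: of_nat_eq_0_iff_char_dvd CHAR_eq_CARD[OF pr] del: of_nat_fact)
    have curve: "(\<Sum>j<?d. poly (M j) t *s w j) \<in> ?D" for t
    proof -
      obtain i where i: "i < ?p" "of_nat i = t" using of_nat_surj_prime_field[OF pr] .
      have "(\<Sum>j<?d. poly (M j) t *s w j) = (\<Sum>j<?d. of_nat (i choose j) *s ((T ^^ j) x v* A))"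
      proof (rule sum.cong[OF refl])
        fix j assume "j \<in> {..<?d}"
        then have nz: "of_nat (fact j) \<noteq> (0 :: 'k)" using fact0 by simp
        have "poly (M j) t = of_nat (fact j) * of_nat (i choose j)"
          unfolding M_def i(2)[symmetric] falling_factorial_poly(3) by (rule of_nat_mult)
        then show "poly (M j) t *s w j = of_nat (i choose j) *s ((T ^^ j) x v* A)"
          using nz by (simp add: w_def del: of_nat_fact)
      qed
      also have "\<dots> = (\<Sum>j<?d. of_nat (i choose j) *s (T ^^ j) x) v* A"
        by (simp add: vec.linear_sum[OF linear_vector_matrix_mult] scalar_vector_matrix_assoc)
      \<comment> \<open>Terms with \<open>j \<ge> d\<close> vanish by nilpotency, those with
        \<open>j > i\<close> because the binomial coefficient is 0.\<close>
      also have "(\<Sum>j<?d. of_nat (i choose j) *s (T ^^ j) x) = (\<Sum>j\<le>i. of_nat (i choose j) *s (T ^^ j) x)"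
      proof -
        have "(\<Sum>j<?d. of_nat (i choose j) *s (T ^^ j) x) = (\<Sum>j\<in>{..<?d} \<union> {..i}. of_nat (i choose j) *s (T ^^ j) x)"
          using T0 by (intro sum.mono_neutral_left) auto
        also have "\<dots> = (\<Sum>j\<le>i. of_nat (i choose j) *s (T ^^ j) x)"
          by (intro sum.mono_neutral_right) (auto simp: binomial_eq_0)
        finally show ?thesis .
      qed
      also have "\<dots> = (\<phi> ^^ i) x" unfolding T_def by (rule funpow_newton[OF lin\<phi>, symmetric])
      finally show ?thesis using inO[OF powO x(2)] by simp
    qed
    let ?X = "U \<union> w ` {1..<?d}"
    obtain n b where nb: "n \<le> ?d * ?d * (vec.dim ?X - vec.dim U)"
      "\<forall>y\<in>vec.span ?X. \<exists>u\<in>U. b + y + u \<in> sumset n ?D"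
      using curve_sums_cover[OF pr U(1) dp M curve] by blast
    \<comment> \<open>This puts index 1 into the range of the curve coefficients;
      \<open>w 1 = (x v* g - x) v* A\<close> lies outside \<open>U\<close> and makes the dimension
      grow.\<close>
    have "?d \<noteq> 1"
    proof
      assume "?d = 1"
      then have "T x = 0" using T0[of 1] by simp
      then show False using x(3) vec.subspace_0[OF U(1)] by (simp add: T_def \<phi>_def)
    qed
    then have "1 \<in> {1..<?d}" using zero_less_card_finite[where 'a='n] by (simp add: le_neq_implies_less)
    then have "w 1 \<in> vec.span ?X" by (intro vec.span_base) blast
    moreover have "w 1 \<notin> U" using x(3) by (simp add: w_def T_def \<phi>_def)
    then have "w 1 \<notin> vec.span U" using U(1) vec.span_eq_iff by blast
    ultimately have "vec.span U \<subset> vec.span ?X" using vec.span_mono[of U ?X] by auto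
    then have "vec.dim U < vec.dim ?X" by (rule vec.dim_psubset)
    moreover have "?d * ?d * (vec.dim ?X - vec.dim U) \<le> 9 * ?d ^ 2 * (vec.dim ?X - vec.dim U)"
      by (simp add: power2_eq_square)
    ultimately have "vec.dim U < vec.dim (vec.span ?X)" "n \<le> 9 * ?d ^ 2 * (vec.dim (vec.span ?X) - vec.dim U)"
      using nb(1) unfolding vec.dim_span by linarith+
    then show ?thesis using nb(2) vec.subspace_span by blast
  qed
qed

text \<open>The cost is proportional to the dimension gained, so it telescopes to
  \<open>9 d^2\<close> times the dimension reached. A step may gain several dimensions, hence the
  inequality \<open>m \<le> vec.dim U\<close> in the induction.\<close>

lemma orbit_covers:
  fixes G :: "('k::{field,finite} ^ 'n ^ 'n) set"
  assumes "prime CARD('k)" "is_linear_group G" "irreducible_lin G" "CARD('k) dvd card G" "v \<noteq> 0"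
  shows "sumset (9 * CARD('n) ^ 3) (orbit_lin G v \<union> {0}) = UNIV"
proof -
  let ?D = "orbit_lin G v \<union> {0}" and ?c = "9 * CARD('n) ^ 2"
  have D0: "0 \<in> ?D" by simp
  have "\<exists>U b. vec.subspace U \<and> m \<le> vec.dim U \<and> (\<forall>y\<in>U. b + y \<in> sumset (?c * vec.dim U) ?D)"
    if "m \<le> CARD('n)" for m
    using that
  proof (induction m)
    case 0
    show ?case by (intro exI[of _ "{0}"] exI[of _ 0]) (simp add: vec.subspace_single_0)
  next
    case (Suc m)
    then obtain U b where U: "vec.subspace U" "m \<le> vec.dim U" "\<forall>y\<in>U. b + y \<in> sumset (?c * vec.dim U) ?D"
      by auto
    show ?case
    proof (cases "U = UNIV")
      case True
      then have "vec.dim U = CARD('n)" using vec_dim_card by metis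
      then show ?thesis using U Suc.prems by (intro exI[of _ U] exI[of _ b]) auto
    next
      case False
      obtain U' n b' where U': "vec.subspace U'" "vec.dim U < vec.dim U'" "n \<le> ?c * (vec.dim U' - vec.dim U)"
        "\<forall>y\<in>U'. \<exists>u\<in>U. b' + y + u \<in> sumset n ?D"
        using orbit_covers_larger_subspace[OF assms U(1) False] by blast
      \<comment> \<open>The sum splits as \<open>(b - u) + (b' + y + u)\<close>, with the first part
        in the old coset and the second in the new sumset.\<close>
      have "b + b' + y \<in> sumset (?c * vec.dim U') ?D" if "y \<in> U'" for y
      proof -
        obtain u where u: "u \<in> U" "b' + y + u \<in> sumset n ?D" using U'(4) \<open>y \<in> U'\<close> by blast
        have "b + - u \<in> sumset (?c * vec.dim U) ?D" using U(3) vec.subspace_neg[OF U(1) u(1)] by blast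
        from sumset_add[OF this u(2)] have "b + b' + y \<in> sumset (?c * vec.dim U + n) ?D"
          by (simp add: algebra_simps)
        moreover have "?c * vec.dim U + n \<le> ?c * vec.dim U'"
        proof -
          have "?c * vec.dim U + ?c * (vec.dim U' - vec.dim U) = ?c * vec.dim U'"
            using U'(2) by (simp flip: distrib_left)
          then show ?thesis using U'(3) by linarith
        qed
        ultimately show ?thesis using sumset_mono[OF D0] by blast
      qed
      then show ?thesis using U' U(2) by (intro exI[of _ U'] exI[of _ "b + b'"]) auto
    qed
  qed
  from this[OF order_refl] obtain U b where U: "vec.subspace U" "CARD('n) \<le> vec.dim U"
    "\<forall>y\<in>U. b + y \<in> sumset (?c * vec.dim U) ?D" by auto
  have dimU: "vec.dim U = CARD('n)" using U(2) dim_subset_UNIV_cart_gen[of U] by simp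
  then have "U = UNIV"
    using vec.subspace_dim_equal[OF U(1) vec.subspace_UNIV] vec_dim_card by (metis order_refl subset_UNIV)
  \<comment> \<open>A coset of the whole space is the whole space, so the shift \<open>b\<close>
    disappears.\<close>
  then have "y \<in> sumset (?c * CARD('n)) ?D" for y
    using U(3) dimU by (metis UNIV_I add.commute diff_add_cancel)
  moreover have "?c * CARD('n) = 9 * CARD('n) ^ 3" by (simp add: power2_eq_square power3_eq_cube)
  ultimately show ?thesis by auto
qed

theorem theorem1p1:
  fixes G :: "('k::{field,finite} ^ 'n ^ 'n) set"
  assumes "prime CARD('k)"
    and "is_linear_group G"
    and "irreducible_lin G"
    and "CARD('k) dvd card G"
  shows "dir_diam G \<le> 9 * CARD('n) ^ 3"
  unfolding dir_diam_def using orbit_covers[OF assms] by (intro Least_le) auto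

end
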